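(* Let $q$ be a prime power, let $n\ge 3$ and $t\ge2$ be integers, and let $N=\theta_{tn-1}=\frac{q^{nt}-1}{q-1}$. For each $j\in\{1,\ldots,t\}$ let $(f_1^j(x),f_2^j(x),f_3^j(x))$ be a triple of $q$-polynomials over $\mathbb{F}_{q^n}$ of one of the following types (where $s$ denotes a positive integer): (1) $(x,x^{q^s},x^{q^{2s}})$ with $\gcd(s,n)=1$; (2) $(x^{q^s},x^{q^{2s}},x+\delta x^{q^{3s}})$ with $\gcd(s,n)=1$, $\delta\in\mathbb{F}_{q^n}$ and $\mathrm{N}_{q^n/q}(\delta)\neq(-1)^{3n}$; (3) $n=7$, $q$ odd, $(x,x^{q^s},x^{q^{3s}})$ with $\gcd(s,7)=1$; (4) $n=8$, $q\equiv1\pmod3$, $(x,x^{q^s},x^{q^{3s}})$ with $\gcd(s,8)=1$. If $G$ is a $(3t\times N)$-matrix over $\mathbb{F}_{q^n}$ whose columns are the vectors of $$\{(f_1^1(x_1),f_2^1(x_1),f_3^1(x_1),\ldots,f_1^t(x_t),f_2^t(x_t),f_3^t(x_t)) : x_1,\ldots,x_t\in\mathbb{F}_{q^n}\}\setminus\{\mathbf{0}\},$$ one chosen for each point of $\mathrm{PG}(3t-1,q^n)$ that they define, then $G$ is the generator matrix of a three-weight linear $[N,3t]_{q^n}$-code.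
   Context: $q$-polynomials over $\mathbb{F}_{q^n}$ are polynomials $\sum_i a_ix^{q^i}$ with $a_i\in\mathbb{F}_{q^n}$, considered modulo $x^{q^n}-x$, i.e. as $\mathbb{F}_q$-linear maps $\mathbb{F}_{q^n}\to\mathbb{F}_{q^n}$. $\mathrm{N}_{q^n/q}$ denotes the norm from $\mathbb{F}_{q^n}$ to $\mathbb{F}_q$. The point of $\mathrm{PG}(3t-1,q^n)$ defined by a nonzero vector $v\in\mathbb{F}_{q^n}^{3t}$ is $\langle v\rangle_{\mathbb{F}_{q^n}}$. An $[N,k]_{q^n}$-code is a $k$-dimensional $\mathbb{F}_{q^n}$-subspace of $\mathbb{F}_{q^n}^N$; a generator matrix is a $(k\times N)$-matrix whose rows form a basis of it. A three-weight code is a linear code whose nonzero codewords have exactly three distinct Hamming weights. *)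

theory Defs
  imports
    "Jordan_Normal_Form.VS_Connect"
    "HOL-Number_Theory.Prime_Powers"
    "HOL-Library.Cardinality"
begin

text \<open>
  Throughout, the field with \<open>q ^ n\<close> elements is a type \<open>'a :: {field, finite}\<close> with
  \<open>CARD('a) = q ^ n\<close>. A \<open>q\<close>-polynomial modulo \<open>x ^ (q ^ n) - x\<close> is the map it induces, so it is
  a function \<open>'a \<Rightarrow> 'a\<close>.
\<close>

text \<open>The norm to the subfield of order \<open>q\<close>: the product of the \<open>n\<close> conjugates.\<close>

definition field_norm :: "nat \<Rightarrow> nat \<Rightarrow> 'a::field \<Rightarrow> 'a" where
  "field_norm q n x = (\<Prod>i<n. x ^ (q ^ i))"

inductive admissible_triple ::
  "nat \<Rightarrow> nat \<Rightarrow> ('a::field \<Rightarrow> 'a) \<Rightarrow> ('a \<Rightarrow> 'a) \<Rightarrow> ('a \<Rightarrow> 'a) \<Rightarrow> bool"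
  for q n :: nat where
  type1: "s > 0 \<Longrightarrow> gcd s n = 1 \<Longrightarrow>
    admissible_triple q n (\<lambda>x. x) (\<lambda>x. x ^ (q ^ s)) (\<lambda>x. x ^ (q ^ (2 * s)))"
| type2: "s > 0 \<Longrightarrow> gcd s n = 1 \<Longrightarrow> field_norm q n \<delta> \<noteq> (- 1) ^ (3 * n) \<Longrightarrow>
    admissible_triple q n
      (\<lambda>x. x ^ (q ^ s)) (\<lambda>x. x ^ (q ^ (2 * s))) (\<lambda>x. x + \<delta> * x ^ (q ^ (3 * s)))"
| type3: "n = 7 \<Longrightarrow> odd q \<Longrightarrow> s > 0 \<Longrightarrow> gcd s 7 = 1 \<Longrightarrow>
    admissible_triple q n (\<lambda>x. x) (\<lambda>x. x ^ (q ^ s)) (\<lambda>x. x ^ (q ^ (3 * s)))"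
| type4: "n = 8 \<Longrightarrow> q mod 3 = 1 \<Longrightarrow> s > 0 \<Longrightarrow> gcd s 8 = 1 \<Longrightarrow>
    admissible_triple q n (\<lambda>x. x) (\<lambda>x. x ^ (q ^ s)) (\<lambda>x. x ^ (q ^ (3 * s)))"

definition triple_vec ::
  "nat \<Rightarrow> (nat \<Rightarrow> 'a \<Rightarrow> 'a) \<Rightarrow> (nat \<Rightarrow> 'a \<Rightarrow> 'a) \<Rightarrow> (nat \<Rightarrow> 'a \<Rightarrow> 'a) \<Rightarrow> (nat \<Rightarrow> 'a) \<Rightarrow> 'a vec" where
  "triple_vec t f1 f2 f3 x =
     vec_of_list (concat (map (\<lambda>j. [f1 j (x j), f2 j (x j), f3 j (x j)]) [1..<t + 1]))"

text \<open>The point of the projective space of the coordinate space that a nonzero vector defines.\<close>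

definition proj_point :: "'a::field vec \<Rightarrow> 'a vec set" where
  "proj_point v = LinearCombinations.module.span class_ring (module_vec TYPE('a) (dim_vec v)) {v}"

definition columns_one_per_point :: "'a::field mat \<Rightarrow> 'a vec set \<Rightarrow> bool" where
  "columns_one_per_point G S \<longleftrightarrow>
     set (cols G) \<subseteq> S \<and>
     bij_betw (\<lambda>j. proj_point (col G j)) {..<dim_col G} (proj_point ` S)"

definition linear_code :: "nat \<Rightarrow> nat \<Rightarrow> 'a::field vec set \<Rightarrow> bool" where
  "linear_code N k C \<longleftrightarrow>
     VectorSpace.subspace class_ring C (module_vec TYPE('a) N) \<and>
     vectorspace.dim class_ring ((module_vec TYPE('a) N)\<lparr>carrier := C\<rparr>) = k"

text \<open>\<open>set (rows G)\<close> forgets repetitions, so distinctness of the rows is required separately.\<close>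

definition generator_matrix :: "nat \<Rightarrow> nat \<Rightarrow> 'a::field mat \<Rightarrow> 'a vec set \<Rightarrow> bool" where
  "generator_matrix N k G C \<longleftrightarrow>
     G \<in> carrier_mat k N \<and> distinct (rows G) \<and>
     vectorspace.basis class_ring ((module_vec TYPE('a) N)\<lparr>carrier := C\<rparr>) (set (rows G))"

definition hamming_weight :: "'a::zero vec \<Rightarrow> nat" where
  "hamming_weight v = card {i. i < dim_vec v \<and> v $ i \<noteq> 0}"

definition three_weight_code :: "nat \<Rightarrow> nat \<Rightarrow> 'a::field vec set \<Rightarrow> bool" where
  "three_weight_code N k C \<longleftrightarrow>
     linear_code N k C \<and> card (hamming_weight ` (C - {0\<^sub>v N})) = 3"

end

theory Submission
  imports Defs "HOL-Number_Theory.Residues"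
begin

text \<open>
  Write \<open>K\<close> for the field of order \<open>q ^ n\<close>, \<open>F\<close> for its subfield of order \<open>q\<close>, and \<open>U\<close> for the set of
  all vectors built from the triples, an \<open>F\<close>-space with at most \<open>q ^ (n * t)\<close> elements. Every
  point defined by \<open>U\<close> contains at least \<open>q - 1\<close> vectors of \<open>U\<close>. Since the matrix has
  \<open>N = (q ^ (n * t) - 1) / (q - 1)\<close> columns, one for each point, \<open>U\<close> must have exactly \<open>q ^ (n * t)\<close>
  elements, and each point exactly \<open>q - 1\<close> vectors (\<open>points_partition\<close>). So the zero coordinates of
  the codeword with coefficient vector \<open>a\<close> are counted by the vectors \<open>u \<in> U\<close> orthogonal to \<open>a\<close>,
  and these in turn by the size of the image of \<open>u \<mapsto> u \<bullet> a\<close>. That image is an \<open>F\<close>-subspace of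
  \<open>K\<close>, hence of size \<open>q ^ k\<close>, and the weight \<open>w\<close> satisfies
  \<open>w * (q - 1) = q ^ (n * t) - q ^ (n * t - k)\<close>. For \<open>a \<noteq> 0\<close> the image contains the image of a nonzero
  combination of one of the triples. Such a combination has at most \<open>q\<^sup>2\<close> roots
  (\<open>card_kernel_admissible\<close>), which leaves only \<open>k = n - 2\<close>, \<open>n - 1\<close> and \<open>n\<close>. All three occur
  already on the first triple (\<open>all_ranks_occur\<close>). The weights are positive, so
  \<open>a \<mapsto> G\<^sup>T a\<close> is injective and the rows of \<open>G\<close> are a basis of the code.

  The bound on the number of roots is the core. Let \<open>\<sigma>\<close> be the \<open>q ^ s\<close>-power map; as \<open>s\<close> is prime
  to \<open>n\<close>, its fixed field is \<open>F\<close>. A nonzero polynomial of degree \<open>d \<le> 2\<close> in \<open>\<sigma>\<close> has at most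
  \<open>q ^ d\<close> roots, by dividing out a root. Suppose that a polynomial of degree 3 has a set \<open>W\<close> of more than
  \<open>q\<^sup>2\<close> roots. On \<open>W\<close> it becomes a recurrence that expresses \<open>\<sigma>\<^sup>3 x\<close> by \<open>x\<close>,
  \<open>\<sigma> x\<close> and \<open>\<sigma>\<^sup>2 x\<close>, and these three functions are linearly independent over \<open>K\<close> on
  \<open>W\<close>. A nonzero Moore determinant of elements of \<open>W\<close> then shows that the coefficient of \<open>x\<close> in the
  recurrence has norm 1, which contradicts the condition on \<open>\<delta>\<close> in the second type. In the
  third and fourth types the recurrence is unrolled up to \<open>\<sigma> ^ n\<close>, the identity, and the coefficients
  are compared: the resulting equations force \<open>2 = 0\<close> if \<open>n = 7\<close>, and if \<open>n = 8\<close> they force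
  \<open>3 = 0\<close> as soon as the cube roots of unity lie in \<open>F\<close>.
\<close>

section \<open>Counting by fibres\<close>

lemma card_le_image_times_fibre:
  assumes "finite A" and "finite B" and "f ` A \<subseteq> B"
    and "\<And>b. b \<in> B \<Longrightarrow> card {x \<in> A. f x = b} \<le> m"
  shows "card A \<le> card B * m"
proof -
  have "A = (\<Union>b\<in>B. {x \<in> A. f x = b})" using assms(3) by auto
  then have "card A \<le> (\<Sum>b\<in>B. card {x \<in> A. f x = b})"
    using card_UN_le[OF assms(2), of "\<lambda>b. {x \<in> A. f x = b}"] by simp
  also have "\<dots> \<le> of_nat (card B) * m"
    by (rule sum_bounded_above) (use assms(4) in auto)
  finally show ?thesis by simp
qed

lemma card_eq_sum_card_fibres:
  assumes "finite A"
  shows "card A = (\<Sum>b\<in>f ` A. card {x \<in> A. f x = b})"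
  using sum.image_gen[OF assms, of "\<lambda>_. 1 :: nat" f] by simp

lemma card_eq_image_times_fibre:
  assumes "finite A" and "\<And>a. a \<in> A \<Longrightarrow> card {x \<in> A. f x = f a} = m"
  shows "card A = card (f ` A) * m"
proof -
  have "card A = (\<Sum>b\<in>f ` A. card {x \<in> A. f x = b})"
    by (rule card_eq_sum_card_fibres[OF assms(1)])
  also have "\<dots> = (\<Sum>b\<in>f ` A. m)" by (rule sum.cong) (use assms(2) in auto)
  finally show ?thesis by simp
qed

section \<open>Polynomials in a field automorphism\<close>

locale field_automorphism =
  fixes \<sigma> :: "'a::{field,finite} \<Rightarrow> 'a" and q :: nat
  assumes hom_add: "\<sigma> (x + y) = \<sigma> x + \<sigma> y"
    and hom_mult: "\<sigma> (x * y) = \<sigma> x * \<sigma> y"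
    and hom_one: "\<sigma> 1 = 1"
    and card_fixed: "card {x. \<sigma> x = x} = q"
begin

lemma hom_zero [simp]: "\<sigma> 0 = 0"
proof -
  have "\<sigma> 0 + \<sigma> 0 = \<sigma> 0 + 0" using hom_add[of 0 0] by simp
  then show ?thesis by (rule add_left_imp_eq)
qed

lemma hom_eq_0_iff [simp]: "\<sigma> x = 0 \<longleftrightarrow> x = 0"
proof
  assume "\<sigma> x = 0"
  show "x = 0"
  proof (rule ccontr)
    assume "x \<noteq> 0"
    then have "\<sigma> x * \<sigma> (inverse x) = 1" by (simp flip: hom_mult add: hom_one)
    with \<open>\<sigma> x = 0\<close> show False by simp
  qed
qed simp

lemma hom_minus: "\<sigma> (- x) = - \<sigma> x"
  using hom_add[of x "- x"] by (simp add: eq_neg_iff_add_eq_0 add.commute)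

lemma hom_diff: "\<sigma> (x - y) = \<sigma> x - \<sigma> y"
  using hom_add[of x "- y"] by (simp add: hom_minus)

lemma hom_divide: "\<sigma> (x / y) = \<sigma> x / \<sigma> y"
proof (cases "y = 0")
  case False
  then have "\<sigma> (x / y) * \<sigma> y = \<sigma> x" by (simp flip: hom_mult)
  with False show ?thesis by (simp add: field_simps)
qed simp

lemmas homs = hom_add hom_mult hom_one hom_minus hom_diff hom_divide

lemma inj_hom: "inj \<sigma>"
  by (rule injI) (metis hom_diff hom_eq_0_iff right_minus_eq)

lemma q_gt_1: "q > 1"
proof -
  have "card {0, 1 :: 'a} \<le> card {x. \<sigma> x = x}" by (rule card_mono) (auto simp: hom_one)
  then show ?thesis by (simp add: card_fixed)
qed

lemma q_le_q2: "q \<le> q\<^sup>2"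
  using q_gt_1 by (simp add: power2_eq_square)

text \<open>
  If \<open>z \<noteq> 0\<close> is a root, then \<open>\<sigma> x / x\<close> takes the same value at every nonzero root, so dividing
  by \<open>z\<close> sends the roots into the fixed field.
\<close>

lemma card_kernel_degree_1:
  assumes "a \<noteq> 0 \<or> b \<noteq> 0"
  shows "card {x. a * x + b * \<sigma> x = 0} \<le> q"
proof (cases "\<exists>z. z \<noteq> 0 \<and> a * z + b * \<sigma> z = 0")
  case False
  then have "{x. a * x + b * \<sigma> x = 0} \<subseteq> {0}" by auto
  then have "card {x. a * x + b * \<sigma> x = 0} \<le> card {0 :: 'a}" by (intro card_mono) auto
  then show ?thesis using q_gt_1 by simp
next
  case True
  then obtain z where z: "z \<noteq> 0" "a * z + b * \<sigma> z = 0" by blast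
  with assms have b: "b \<noteq> 0" by auto
  have root: "\<sigma> x = - a / b * x" if "a * x + b * \<sigma> x = 0" for x
    using that b by (simp add: field_simps) (metis add.commute eq_neg_iff_add_eq_0)
  have a: "a \<noteq> 0" using z b by auto
  have "(\<lambda>x. x / z) ` {x. a * x + b * \<sigma> x = 0} \<subseteq> {x. \<sigma> x = x}"
  proof clarify
    fix x assume "a * x + b * \<sigma> x = 0"
    then have "\<sigma> x = - a / b * x" by (rule root)
    moreover have "\<sigma> z = - a / b * z" by (rule root[OF z(2)])
    ultimately show "\<sigma> (x / z) = x / z" using a b by (simp only: hom_divide) simp
  qed
  moreover have "inj_on (\<lambda>x. x / z) {x. a * x + b * \<sigma> x = 0}"
    using z(1) by (auto simp: inj_on_def)
  ultimately show ?thesis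
    using card_inj_on_le[of "\<lambda>x. x / z" "{x. a * x + b * \<sigma> x = 0}" "{x. \<sigma> x = x}"]
    by (simp add: card_fixed)
qed

text \<open>
  The proof lowers the degree by dividing out a root \<open>z\<close>. The polynomial \<open>p (y * z)\<close> in \<open>y\<close> vanishes
  at \<open>y = 1\<close>, so its coefficients sum to 0 and it is a polynomial of degree 1 in
  \<open>\<sigma> y - y\<close>. That has at most \<open>q\<close> roots, and each value of \<open>\<sigma> y - y\<close> is attained on a coset
  of the fixed field.
\<close>

lemma card_kernel_degree_2:
  assumes "a \<noteq> 0 \<or> b \<noteq> 0 \<or> c \<noteq> 0"
  shows "card {x. a * x + b * \<sigma> x + c * \<sigma> (\<sigma> x) = 0} \<le> q\<^sup>2" (is "card ?K \<le> _")
proof (cases "\<exists>z. z \<noteq> 0 \<and> z \<in> ?K")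
  case False
  then have "?K \<subseteq> {0}" by auto
  then have "card ?K \<le> card {0 :: 'a}" by (intro card_mono) auto
  then show ?thesis using q_gt_1 q_le_q2 by simp
next
  case True
  then obtain z where z: "z \<noteq> 0" "a * z + b * \<sigma> z + c * \<sigma> (\<sigma> z) = 0" by blast
  define a' b' c' where abc: "a' = a * z" "b' = b * \<sigma> z" "c' = c * \<sigma> (\<sigma> z)"
  have sum0: "a' + b' + c' = 0" using z by (simp add: abc)
  have nz: "b' + c' \<noteq> 0 \<or> c' \<noteq> 0" using assms z(1) sum0 by (auto simp: abc)
  define h where "h x = \<sigma> (x / z) - x / z" for x
  let ?L = "{y. (b' + c') * y + c' * \<sigma> y = 0}"
  have "h ` ?K \<subseteq> ?L"
  proof clarify
    fix x assume x: "a * x + b * \<sigma> x + c * \<sigma> (\<sigma> x) = 0"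
    define y where "y = x / z"
    have xy: "x = y * z" using z(1) by (simp add: y_def)
    have "a' * y + b' * \<sigma> y + c' * \<sigma> (\<sigma> y) = 0"
      using x by (simp add: abc xy homs algebra_simps)
    moreover have "a' = - b' - c'" using sum0 by (simp add: algebra_simps eq_neg_iff_add_eq_0)
    ultimately show "(b' + c') * h x + c' * \<sigma> (h x) = 0"
      by (simp add: h_def homs flip: y_def) (simp add: algebra_simps)
  qed
  moreover have "card {x \<in> ?K. h x = y} \<le> q" for y
  proof (cases "\<exists>u. h u = y")
    case True
    then obtain u where u: "h u = y" by blast
    have "(\<lambda>x. (x - u) / z) ` {x \<in> ?K. h x = y} \<subseteq> {x. \<sigma> x = x}"
      using u by (auto simp: h_def homs diff_divide_distrib algebra_simps)
    moreover have "inj_on (\<lambda>x. (x - u) / z) {x \<in> ?K. h x = y}"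
      using z(1) by (auto simp: inj_on_def)
    ultimately show ?thesis
      using card_inj_on_le[of "\<lambda>x. (x - u) / z" "{x \<in> ?K. h x = y}" "{x. \<sigma> x = x}"]
      by (simp add: card_fixed)
  qed auto
  ultimately have "card ?K \<le> card ?L * q"
    by (intro card_le_image_times_fibre) auto
  also have "card ?L \<le> q" by (rule card_kernel_degree_1) (use nz in auto)
  finally show ?thesis by (simp add: power2_eq_square)
qed

lemma coefficients_eq_0:
  assumes "card W > q\<^sup>2" and "\<And>x. x \<in> W \<Longrightarrow> a * x + b * \<sigma> x + c * \<sigma> (\<sigma> x) = 0"
  shows "a = 0" "b = 0" "c = 0"
proof -
  have "W \<subseteq> {x. a * x + b * \<sigma> x + c * \<sigma> (\<sigma> x) = 0}" using assms(2) by auto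
  then have "q\<^sup>2 < card {x. a * x + b * \<sigma> x + c * \<sigma> (\<sigma> x) = 0}"
    using assms(1) by (meson card_mono finite less_le_trans)
  with card_kernel_degree_2[of a b c] show "a = 0" "b = 0" "c = 0" by linarith+
qed

text \<open>
  A set of more than \<open>q\<^sup>2\<close> elements is too large for a polynomial of degree 2, so
  \<open>x\<close>, \<open>\<sigma> x\<close> and \<open>\<sigma>\<^sup>2 x\<close> are linearly independent as functions on it. All arguments
  about polynomials of degree 3 with too many roots compare coefficients in this basis.
\<close>

lemma coefficients_unique:
  assumes "card W > q\<^sup>2"
    and "\<And>x. x \<in> W \<Longrightarrow> a * x + b * \<sigma> x + c * \<sigma> (\<sigma> x) = a' * x + b' * \<sigma> x + c' * \<sigma> (\<sigma> x)"
  shows "a = a'" "b = b'" "c = c'"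
proof -
  have *: "(a - a') * x + (b - b') * \<sigma> x + (c - c') * \<sigma> (\<sigma> x) = 0" if "x \<in> W" for x
    using assms(2)[OF that] by (simp add: algebra_simps)
  show "a = a'" "b = b'" "c = c'" using coefficients_eq_0[OF assms(1) *] by simp_all
qed

text \<open>
  The element \<open>d\<close> is the Moore determinant of three elements \<open>x\<close>, \<open>y\<close>, \<open>z\<close> of \<open>W\<close>, the
  determinant with rows \<open>x, \<sigma> x, \<sigma>\<^sup>2 x\<close> and so on. Applying \<open>\<sigma>\<close> shifts its columns, and
  the recurrence replaces the new column \<open>\<sigma>\<^sup>3\<close> by \<open>a\<close> times the old first one. Choosing
  \<open>x\<close>, \<open>y\<close>, \<open>z\<close> one after the other keeps the leading minors nonzero: each minor is a
  nonzero polynomial of degree at most 2 in the last element chosen, so it cannot vanish on \<open>W\<close>.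
\<close>

lemma Moore_determinant_semi_invariant:
  assumes "card W > q\<^sup>2"
    and W: "\<And>x. x \<in> W \<Longrightarrow> \<sigma> (\<sigma> (\<sigma> x)) = a * x + b * \<sigma> x + c * \<sigma> (\<sigma> x)"
  shows "\<exists>d. d \<noteq> 0 \<and> \<sigma> d = a * d"
proof -
  have ex: "\<exists>x\<in>W. r * x + s * \<sigma> x + u * \<sigma> (\<sigma> x) \<noteq> 0" if "r \<noteq> 0 \<or> s \<noteq> 0 \<or> u \<noteq> 0" for r s u
    using coefficients_eq_0[OF assms(1), of r s u] that by blast
  obtain x where x: "x \<in> W" "x \<noteq> 0" using ex[of 1 0 0] by auto
  obtain y where y: "y \<in> W" "x * \<sigma> y - \<sigma> x * y \<noteq> 0"
    using ex[of "- \<sigma> x" x 0] x by auto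
  define D where "D z = (\<sigma> x * \<sigma> (\<sigma> y) - \<sigma> (\<sigma> x) * \<sigma> y) * z
      + (\<sigma> (\<sigma> x) * y - x * \<sigma> (\<sigma> y)) * \<sigma> z + (x * \<sigma> y - \<sigma> x * y) * \<sigma> (\<sigma> z)" for z
  obtain z where z: "z \<in> W" "D z \<noteq> 0"
    using ex[of "\<sigma> x * \<sigma> (\<sigma> y) - \<sigma> (\<sigma> x) * \<sigma> y" "\<sigma> (\<sigma> x) * y - x * \<sigma> (\<sigma> y)" "x * \<sigma> y - \<sigma> x * y"]
      y by (auto simp: D_def)
  have "\<sigma> (D z) = a * D z"
    by (simp add: D_def homs W[OF x(1)] W[OF y(1)] W[OF z(1)]) (simp add: algebra_simps)
  with z show ?thesis by blast
qed

lemma prod_conjugates_times: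
  assumes "\<sigma> d = a * d"
  shows "(\<Prod>i<n. (\<sigma> ^^ i) a) * d = (\<sigma> ^^ n) d"
proof -
  have hom: "(\<sigma> ^^ k) (x * y) = (\<sigma> ^^ k) x * (\<sigma> ^^ k) y" for k x y
    by (induction k) (simp_all add: hom_mult)
  show ?thesis
  proof (induction n)
    case (Suc n)
    have "(\<sigma> ^^ Suc n) d = (\<sigma> ^^ n) (a * d)" using assms by (simp add: funpow_swap1)
    then show ?case using Suc.IH by (simp add: hom mult_ac)
  qed simp
qed

text \<open>
  Iterating \<open>\<sigma> d = a * d\<close> over a full period of \<open>\<sigma>\<close> returns to \<open>d\<close>, so the conjugates of \<open>a\<close>
  multiply to 1.
\<close>

lemma norm_eq_1_of_large_kernel:
  assumes "\<And>x. (\<sigma> ^^ n) x = x" and "card W > q\<^sup>2"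
    and "\<And>x. x \<in> W \<Longrightarrow> \<sigma> (\<sigma> (\<sigma> x)) = a * x + b * \<sigma> x + c * \<sigma> (\<sigma> x)"
  shows "(\<Prod>i<n. (\<sigma> ^^ i) a) = 1"
proof -
  obtain d where "d \<noteq> 0" "\<sigma> d = a * d"
    using Moore_determinant_semi_invariant[OF assms(2,3)] by blast
  with prod_conjugates_times[of d a n] assms(1) show ?thesis by simp
qed

text \<open>
  The recurrence has no term in \<open>\<sigma>\<^sup>2 x\<close>, which keeps the expansions of the higher
  powers of \<open>\<sigma>\<close> short. The exponents 7 and 8 are the two periods for which the coefficients are
  compared with those of the identity.
\<close>

lemma trinomial_recurrence:
  assumes c: "\<And>x. x \<in> W \<Longrightarrow> \<sigma> (\<sigma> (\<sigma> x)) = a * x + b * \<sigma> x"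
  assumes x: "x \<in> W"
  shows "(\<sigma> ^^ 7) x = (\<sigma> ^^ 4) b * (\<sigma> ^^ 2) b * a * x
      + ((\<sigma> ^^ 4) a * \<sigma> a + (\<sigma> ^^ 4) b * (\<sigma> ^^ 2) b * b) * \<sigma> x
      + ((\<sigma> ^^ 4) a * \<sigma> b + (\<sigma> ^^ 4) b * (\<sigma> ^^ 2) a) * \<sigma> (\<sigma> x)"
    and "(\<sigma> ^^ 8) x = ((\<sigma> ^^ 5) a * (\<sigma> ^^ 2) b + (\<sigma> ^^ 5) b * (\<sigma> ^^ 3) a) * a * x
      + ((\<sigma> ^^ 5) a * (\<sigma> ^^ 2) b * b + (\<sigma> ^^ 5) b * (\<sigma> ^^ 3) a * b
          + (\<sigma> ^^ 5) b * (\<sigma> ^^ 3) b * \<sigma> a) * \<sigma> x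
      + ((\<sigma> ^^ 5) a * (\<sigma> ^^ 2) a + (\<sigma> ^^ 5) b * (\<sigma> ^^ 3) b * \<sigma> b) * \<sigma> (\<sigma> x)"
  using c[OF x] by (simp_all add: eval_nat_numeral homs) (simp_all add: algebra_simps)

text \<open>
  With more than \<open>q\<^sup>2\<close> roots the coefficient \<open>c\<close> cannot vanish, since the polynomial would
  then have degree at most 1.
\<close>

lemma trinomial_reduce:
  assumes "card {x. a * x + b * \<sigma> x + c * \<sigma> (\<sigma> (\<sigma> x)) = 0} > q\<^sup>2" (is "card ?W > _")
    and "a \<noteq> 0 \<or> b \<noteq> 0 \<or> c \<noteq> 0"
  shows "\<exists>a' b'. \<forall>x\<in>?W. \<sigma> (\<sigma> (\<sigma> x)) = a' * x + b' * \<sigma> x"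
proof -
  have "c \<noteq> 0"
  proof
    assume "c = 0"
    then have "card ?W \<le> q" using card_kernel_degree_1[of a b] assms(2) by simp
    with assms(1) q_le_q2 show False by simp
  qed
  then have "\<sigma> (\<sigma> (\<sigma> x)) = - a / c * x + - b / c * \<sigma> x" if "x \<in> ?W" for x
  proof -
    have "a * x + b * \<sigma> x + c * \<sigma> (\<sigma> (\<sigma> x)) = 0" using that by simp
    then have "c * \<sigma> (\<sigma> (\<sigma> x)) = - (a * x + b * \<sigma> x)" by (metis add.commute eq_neg_iff_add_eq_0)
    then have "\<sigma> (\<sigma> (\<sigma> x)) = - (a * x + b * \<sigma> x) / c" by (metis \<open>c \<noteq> 0\<close> nonzero_mult_div_cancel_left)
    also have "\<dots> = - a / c * x + - b / c * \<sigma> x" by (simp add: diff_divide_distrib)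
    finally show ?thesis .
  qed
  then show ?thesis by blast
qed

text \<open>
  On a set of more than \<open>q\<^sup>2\<close> roots the coefficients of \<open>\<sigma>\<^sup>7 x = x\<close> must match. Write
  \<open>A k\<close> and \<open>B k\<close> for the conjugates of the two coefficients. The coefficient of \<open>x\<close> says that
  \<open>B (k + 4) * B (k + 2)\<close> is inverse to \<open>A k\<close>; substituted into the vanishing coefficient of
  \<open>\<sigma>\<^sup>2 x\<close>, it makes both terms equal to the inverse of \<open>B 6\<close>. Their sum is zero, so
  \<open>2 = 0\<close>.
\<close>

lemma card_kernel_trinomial_7:
  assumes period: "\<And>x. (\<sigma> ^^ 7) x = x" and "(2 :: 'a) \<noteq> 0"
    and nz: "a \<noteq> 0 \<or> b \<noteq> 0 \<or> c \<noteq> 0"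
  shows "card {x. a * x + b * \<sigma> x + c * \<sigma> (\<sigma> (\<sigma> x)) = 0} \<le> q\<^sup>2" (is "card ?W \<le> _")
proof (rule ccontr)
  assume "\<not> card ?W \<le> q\<^sup>2"
  then have large: "card ?W > q\<^sup>2" by simp
  obtain \<alpha> \<beta> where W: "\<And>x. x \<in> ?W \<Longrightarrow> \<sigma> (\<sigma> (\<sigma> x)) = \<alpha> * x + \<beta> * \<sigma> x"
    using trinomial_reduce[OF large nz] by blast
  define A B where "A k = (\<sigma> ^^ k) \<alpha>" and "B k = (\<sigma> ^^ k) \<beta>" for k
  have s: "\<sigma> (A k) = A (Suc k)" "\<sigma> (B k) = B (Suc k)" for k by (simp_all add: A_def B_def)
  have rel: "B 4 * B 2 * A 0 * x + (A 4 * A 1 + B 4 * B 2 * B 0) * \<sigma> x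
      + (A 4 * B 1 + B 4 * A 2) * \<sigma> (\<sigma> x) = 1 * x + 0 * \<sigma> x + 0 * \<sigma> (\<sigma> x)" if "x \<in> ?W" for x
    using trinomial_recurrence(1)[OF W that] by (simp add: period A_def B_def)
  have e1: "B (k + 4) * B (k + 2) * A k = 1" for k
  proof (induction k)
    case 0
    then show ?case using coefficients_unique(1)[OF large rel] by (simp only: add_0_left)
  next
    case (Suc k)
    show ?case using arg_cong[OF Suc, of \<sigma>] by (simp only: homs s add_Suc hom_zero)
  qed
  have e3: "A 4 * B 1 + B 4 * A 2 = 0" by (rule coefficients_unique(3)[OF large rel])
  \<comment> \<open>The period is 7, so the instances 2 and 4 of the first relation share the factor \<open>B 6\<close>.\<close>
  have B8: "B 8 = B 1" using period[of "\<sigma> \<beta>"] by (simp add: B_def eval_nat_numeral)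
  have "2 = B 8 * B 6 * A 4 + B 6 * B 4 * A 2" using e1[of 4] e1[of 2] by simp
  also have "\<dots> = B 6 * (A 4 * B 1 + B 4 * A 2)" by (simp add: B8 algebra_simps)
  also have "\<dots> = 0" by (simp only: e3) simp
  finally show False using assms(2) by simp
qed

text \<open>
  As for period 7, the coefficients of \<open>\<sigma>\<^sup>8 x = x\<close> must match on a large set of roots. The
  coefficient of \<open>x\<close> splits 1 as \<open>u + v\<close>. The coefficient of \<open>\<sigma>\<^sup>2 x\<close> turns
  \<open>u\<close> and \<open>v\<close> into the negated products of the conjugates \<open>B k\<close> over even and over odd \<open>k\<close>, so
  \<open>\<sigma> v = u\<close>; together with the coefficient of \<open>\<sigma> x\<close> it gives \<open>u * v = 1\<close>. Then \<open>- v\<close> is a cube root of unity, \<open>\<sigma>\<close> fixes it, and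
  \<open>u = v\<close> yields \<open>1 = (u + v)\<^sup>2 = 4 * u * v = 4\<close>.
\<close>

lemma card_kernel_trinomial_8:
  assumes period: "\<And>x. (\<sigma> ^^ 8) x = x" and "(3 :: 'a) \<noteq> 0"
    and root: "\<And>w. w ^ 3 = 1 \<Longrightarrow> \<sigma> w = w"
    and nz: "a \<noteq> 0 \<or> b \<noteq> 0 \<or> c \<noteq> 0"
  shows "card {x. a * x + b * \<sigma> x + c * \<sigma> (\<sigma> (\<sigma> x)) = 0} \<le> q\<^sup>2" (is "card ?W \<le> _")
proof (rule ccontr)
  assume "\<not> card ?W \<le> q\<^sup>2"
  then have large: "card ?W > q\<^sup>2" by simp
  obtain \<alpha> \<beta> where W: "\<And>x. x \<in> ?W \<Longrightarrow> \<sigma> (\<sigma> (\<sigma> x)) = \<alpha> * x + \<beta> * \<sigma> x"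
    using trinomial_reduce[OF large nz] by blast
  define A B where "A k = (\<sigma> ^^ k) \<alpha>" and "B k = (\<sigma> ^^ k) \<beta>" for k
  have s: "\<sigma> (A k) = A (Suc k)" "\<sigma> (B k) = B (Suc k)" for k by (simp_all add: A_def B_def)
  have p: "A (k + 8) = A k" "B (k + 8) = B k" for k
    by (simp_all add: A_def B_def funpow_add period)
  have rel: "(A 5 * B 2 + B 5 * A 3) * A 0 * x
      + (A 5 * B 2 * B 0 + B 5 * A 3 * B 0 + B 5 * B 3 * A 1) * \<sigma> x
      + (A 5 * A 2 + B 5 * B 3 * B 1) * \<sigma> (\<sigma> x) = 1 * x + 0 * \<sigma> x + 0 * \<sigma> (\<sigma> x)"
    if "x \<in> ?W" for x
    using trinomial_recurrence(2)[OF W that] by (simp add: period A_def B_def)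
  have e1: "(A (k + 5) * B (k + 2) + B (k + 5) * A (k + 3)) * A k = 1" for k
  proof (induction k)
    case 0
    then show ?case using coefficients_unique(1)[OF large rel] by (simp only: add_0_left)
  next
    case (Suc k)
    show ?case using arg_cong[OF Suc, of \<sigma>] by (simp only: homs s add_Suc hom_zero)
  qed
  have e2: "(A (k + 5) * B (k + 2) + B (k + 5) * A (k + 3)) * B k + B (k + 5) * B (k + 3) * A (k + 1) = 0" for k
  proof (induction k)
    case 0
    then show ?case using coefficients_unique(2)[OF large rel] by (simp only: add_0_left distrib_right)
  next
    case (Suc k)
    show ?case using arg_cong[OF Suc, of \<sigma>] by (simp only: homs s add_Suc hom_zero)
  qed
  have e3: "A (k + 5) * A (k + 2) = - (B (k + 5) * B (k + 3) * B (k + 1))" for k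
  proof (induction k)
    case 0
    then show ?case using coefficients_unique(3)[OF large rel] by (simp only: add_0_left eq_neg_iff_add_eq_0)
  next
    case (Suc k)
    show ?case using arg_cong[OF Suc, of \<sigma>] by (simp only: homs s add_Suc hom_zero)
  qed
  have A_nz: "A k \<noteq> 0" for k using e1[of k] by auto
  have B_nz: "B k \<noteq> 0" for k
  proof
    assume "B k = 0"
    then have "(\<sigma> ^^ m) (B k) = 0" for m by (induction m) simp_all
    then have "B (m + k) = 0" for m by (simp add: B_def funpow_add)
    from this[of 5] have "B (k + 5) = 0" by (simp add: add.commute)
    with e3[of k] A_nz show False by simp
  qed
  \<comment> \<open>Multiply the vanishing coefficient of \<open>\<sigma> x\<close> by \<open>A k\<close> and use the coefficient of \<open>x\<close>.\<close>
  have e2': "B k = - (A k * A (k + 1) * B (k + 3) * B (k + 5))" for k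
  proof -
    let ?S = "A (k + 5) * B (k + 2) + B (k + 5) * A (k + 3)"
    have "B k = (?S * A k) * B k" by (simp only: e1) simp
    also have "\<dots> = A k * (?S * B k)" by (simp only: mult_ac)
    also have "?S * B k = - (B (k + 5) * B (k + 3) * A (k + 1))"
      using e2[of k] by (simp only: eq_neg_iff_add_eq_0)
    finally show ?thesis by (simp add: mult_ac)
  qed
  define u v where "u = A 0 * A 5 * B 2" and "v = A 0 * A 3 * B 5"
  \<comment> \<open>Indices are read modulo 8: the instances 6, 3 and 7 of the last coefficient equation.\<close>
  have A03: "A 0 * A 3 = - (B 1 * B 3 * B 7)"
    using e3[of 6] p(1)[of 0] p(1)[of 3] p(2)[of 3] p(2)[of 1] by (simp add: mult_ac)
  have A05: "A 0 * A 5 = - (B 0 * B 4 * B 6)"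
    using e3[of 3] p(1)[of 0] p(2)[of 0] by (simp add: mult_ac)
  have A14: "A 1 * A 4 = - (B 0 * B 2 * B 4)"
    using e3[of 7] p(1)[of 1] p(1)[of 4] p(2)[of 0] p(2)[of 2] p(2)[of 4] by (simp add: mult_ac)
  have v: "v = - (B 1 * B 3 * B 5 * B 7)" by (simp add: v_def A03)
  have u: "u = - (B 0 * B 2 * B 4 * B 6)" by (simp add: u_def A05)
  have sv: "\<sigma> v = u" using p(2)[of 0] by (simp add: u v homs s mult_ac numeral_2_eq_2)
  have sum: "u + v = 1" using e1[of 0] by (simp add: u_def v_def algebra_simps numeral_2_eq_2)
  have prod: "u * v = 1"
  proof -
    \<comment> \<open>The products of \<open>A\<close> at indices of distance 1 regroup into products at distance 3, which are known.\<close>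
    have "B 0 * B 3 = (A 0 * A 1 * B 3 * B 5) * (A 3 * A 4 * B 6 * B 0)"
      using e2'[of 0] e2'[of 3] p(2)[of 0] by (simp add: mult_ac)
    also have "\<dots> = (B 0 * B 3) * ((A 0 * A 3) * (A 1 * A 4) * B 5 * B 6)" by (simp add: mult_ac)
    finally have "1 = (A 0 * A 3) * (A 1 * A 4) * B 5 * B 6" using B_nz by simp
    also have "\<dots> = u * v" by (simp only: A03 A14 u v) (simp add: mult_ac)
    finally show ?thesis by simp
  qed
  have "(- v) ^ 3 = 1"
  proof -
    have "v * v = (u + v) * v - u * v" by (simp add: algebra_simps)
    then have *: "v * v = v - 1" by (simp only: sum prod mult_1_left)
    have "(- v) ^ 3 = - (v * v) * v" by (simp add: power3_eq_cube)
    also have "\<dots> = 1" by (simp add: * algebra_simps)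
    finally show ?thesis .
  qed
  then have "\<sigma> (- v) = - v" by (rule root)
  then have uv: "u = v" using sv by (simp add: hom_minus)
  have "1 = (u + v) * (u + v)" by (simp add: sum)
  also have "\<dots> = 4 * (u * v)" by (simp add: uv algebra_simps)
  finally have four: "4 = (1 :: 'a)" by (simp add: prod)
  have "(3 :: 'a) = 4 - 1" by simp
  also have "\<dots> = 0" by (simp only: four) simp
  finally show False using assms(2) by blast
qed

section \<open>Subspaces over the fixed field\<close>

definition fixed_subspace :: "'a set \<Rightarrow> bool" where
  "fixed_subspace S \<longleftrightarrow> 0 \<in> S \<and> (\<forall>x\<in>S. \<forall>y\<in>S. x + y \<in> S) \<and> (\<forall>c x. \<sigma> c = c \<longrightarrow> x \<in> S \<longrightarrow> c * x \<in> S)"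

lemma fixed_subspace_diff:
  assumes "fixed_subspace S" "x \<in> S" "y \<in> S"
  shows "x - y \<in> S"
proof -
  have "\<sigma> (- 1) = - 1" by (simp add: hom_minus hom_one)
  then have "- 1 * y \<in> S" using assms unfolding fixed_subspace_def by blast
  then have "x + - 1 * y \<in> S" using assms unfolding fixed_subspace_def by blast
  then show ?thesis by simp
qed

lemma fixed_subspace_extend:
  assumes T: "fixed_subspace T" and s: "s \<notin> T"
  defines "T' \<equiv> (\<lambda>(t, c). t + c * s) ` (T \<times> {c. \<sigma> c = c})"
  shows "fixed_subspace T'" and "card T' = card T * q"
proof -
  have T'_iff: "x \<in> T' \<longleftrightarrow> (\<exists>t c. t \<in> T \<and> \<sigma> c = c \<and> x = t + c * s)" for x
    by (auto simp: T'_def)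
  show "fixed_subspace T'"
    unfolding fixed_subspace_def
  proof (intro conjI ballI allI impI)
    show "0 \<in> T'" using T by (auto simp: T'_iff fixed_subspace_def intro!: exI[of _ 0])
  next
    fix x y assume "x \<in> T'" "y \<in> T'"
    then obtain t c t' c' where "t \<in> T" "\<sigma> c = c" "x = t + c * s" "t' \<in> T" "\<sigma> c' = c'" "y = t' + c' * s"
      by (auto simp: T'_iff)
    then show "x + y \<in> T'"
      using T unfolding T'_iff
      by (intro exI[of _ "t + t'"] exI[of _ "c + c'"]) (auto simp: fixed_subspace_def homs algebra_simps)
  next
    fix d x assume d: "\<sigma> d = d" and "x \<in> T'"
    then obtain t c where "t \<in> T" "\<sigma> c = c" "x = t + c * s" by (auto simp: T'_iff)
    then show "d * x \<in> T'"
      using T d unfolding T'_iff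
      by (intro exI[of _ "d * t"] exI[of _ "d * c"]) (auto simp: fixed_subspace_def homs algebra_simps)
  qed
  have "inj_on (\<lambda>(t, c). t + c * s) (T \<times> {c. \<sigma> c = c})"
  proof (rule inj_onI, clarify)
    fix t c t' c' assume *: "t \<in> T" "\<sigma> c = c" "t' \<in> T" "\<sigma> c' = c'" "t + c * s = t' + c' * s"
    have "c = c'"
    proof (rule ccontr)
      assume "c \<noteq> c'"
      have "(c - c') * s = t' - t" using *(5) by (simp add: algebra_simps)
      then have "s = inverse (c - c') * (t' - t)" using \<open>c \<noteq> c'\<close> by (simp add: field_simps)
      moreover have "t' - t \<in> T" using fixed_subspace_diff[OF T *(3,1)] .
      moreover have "\<sigma> (inverse (c - c')) = inverse (c - c')"
        using *(2,4) by (simp add: inverse_eq_divide homs)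
      ultimately show False using T s by (auto simp: fixed_subspace_def)
    qed
    with *(5) show "t = t' \<and> c = c'" by simp
  qed
  then show "card T' = card T * q"
    unfolding T'_def by (simp add: card_image card_cartesian_product card_fixed)
qed

text \<open>
  A subspace of maximal order among those with \<open>q ^ k\<close> elements is the whole of \<open>S\<close>, because any
  further element of \<open>S\<close> would extend it by the factor \<open>q\<close>.
\<close>

lemma card_fixed_subspace:
  assumes S: "fixed_subspace S"
  shows "\<exists>k. card S = q ^ k"
proof -
  define P where "P T \<longleftrightarrow> fixed_subspace T \<and> T \<subseteq> S \<and> (\<exists>k. card T = q ^ k)" for T
  have "P {0}" using S by (auto simp: P_def fixed_subspace_def intro: exI[of _ 0])
  moreover have "\<forall>T. P T \<longrightarrow> card T < Suc (card S)"
    by (auto simp: P_def less_Suc_eq_le intro!: card_mono)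
  ultimately have "\<exists>T. P T \<and> (\<forall>U. P U \<longrightarrow> card U \<le> card T)"
    by (rule Lattices_Big.ex_has_greatest_nat)
  then obtain T where T: "P T" and max: "\<And>U. P U \<Longrightarrow> card U \<le> card T" by blast
  obtain k where k: "card T = q ^ k" using T by (auto simp: P_def)
  have sub: "fixed_subspace T" using T by (simp add: P_def)
  have "T = S"
  proof (rule ccontr)
    assume "T \<noteq> S"
    then obtain s where s: "s \<in> S" "s \<notin> T" using T by (auto simp: P_def)
    let ?T' = "(\<lambda>(t, c). t + c * s) ` (T \<times> {c. \<sigma> c = c})"
    have "?T' \<subseteq> S"
    proof clarify
      fix t c assume "t \<in> T" and c: "\<sigma> c = c"
      then have "t \<in> S" "c * s \<in> S" using S s(1) T c by (auto simp: fixed_subspace_def P_def)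
      then show "t + c * s \<in> S" using S by (simp add: fixed_subspace_def)
    qed
    then have "P ?T'"
      using fixed_subspace_extend[OF sub s(2)] k unfolding P_def
      by (intro conjI exI[of _ "Suc k"]) simp_all
    then have "card T * q \<le> card T" using max[OF \<open>P ?T'\<close>]
      by (simp only: fixed_subspace_extend(2)[OF sub s(2)])
    then show False using k q_gt_1 by simp
  qed
  with k show ?thesis by blast
qed

end

section \<open>Frobenius powers of a finite field\<close>

lemma pred_dvd_power_pred: "(q - 1 :: nat) dvd q ^ n - 1"
proof (induction n)
  case (Suc n)
  show ?case
  proof (cases "q = 0")
    case False
    then have "q ^ Suc n - 1 = q * (q ^ n - 1) + (q - 1)"
      by (simp add: diff_mult_distrib2)
    then show ?thesis using Suc by simp
  qed simp
qed simp

lemma card_roots_power_le: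
  fixes c :: "'a::{field,finite}"
  assumes "m > 0"
  shows "card {x. x ^ m = c} \<le> m"
proof -
  let ?p = "Polynomial.monom 1 m + [:- c:]"
  have deg: "degree ?p = m" using assms
    by (subst degree_add_eq_left) (simp_all add: Polynomial.degree_monom_eq)
  then have "?p \<noteq> 0" using assms by auto
  then have "card {x. poly ?p x = 0} \<le> m" using card_poly_roots_bound[of ?p] deg by simp
  then show ?thesis by (simp add: Polynomial.poly_monom)
qed

lemma finite_field_power_card:
  fixes x :: "'a::{field,finite}"
  shows "x ^ CARD('a) = x"
proof (cases "x = 0")
  case False
  let ?U = "UNIV - {0 :: 'a}"
  have bij: "bij_betw ((*) x) ?U ?U"
    by (rule bij_betw_byWitness[where f' = "\<lambda>y. y / x"]) (use False in auto)
  have "prod id ?U = (\<Prod>y\<in>?U. x * y)"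
    using prod.reindex_bij_betw[OF bij, of id] by simp
  also have "\<dots> = x ^ card ?U * prod id ?U" by (simp add: prod.distrib)
  finally have "x ^ card ?U = 1" by simp
  moreover have "Suc (card ?U) = CARD('a)" by (rule card_Suc_Diff1) auto
  ultimately show ?thesis by (metis power_Suc mult.right_neutral)
qed simp

text \<open>
  The cross product serves, unless the two vectors are proportional. In that case a
  vector orthogonal to a nonzero one of them is orthogonal to both.
\<close>

lemma ex_orthogonal_to_two:
  fixes u1 u2 u3 v1 v2 v3 :: "'a::field"
  shows "\<exists>a b c. (a \<noteq> 0 \<or> b \<noteq> 0 \<or> c \<noteq> 0) \<and>
    a * u1 + b * u2 + c * u3 = 0 \<and> a * v1 + b * v2 + c * v3 = 0"
proof -
  let ?P = "\<lambda>a b c. (a \<noteq> 0 \<or> b \<noteq> 0 \<or> c \<noteq> 0) \<and>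
    a * u1 + b * u2 + c * u3 = 0 \<and> a * v1 + b * v2 + c * v3 = 0"
  consider "u2 * v3 - u3 * v2 \<noteq> 0 \<or> u3 * v1 - u1 * v3 \<noteq> 0 \<or> u1 * v2 - u2 * v1 \<noteq> 0"
    | (dep) "u2 * v3 = u3 * v2" "u3 * v1 = u1 * v3" "u1 * v2 = u2 * v1"
    by fastforce
  then show ?thesis
  proof cases
    case 1
    then have "?P (u2 * v3 - u3 * v2) (u3 * v1 - u1 * v3) (u1 * v2 - u2 * v1)"
      by (simp add: algebra_simps)
    then show ?thesis by blast
  next
    case dep
    consider "u1 \<noteq> 0 \<or> u2 \<noteq> 0" | "u3 \<noteq> 0" | "v1 \<noteq> 0 \<or> v2 \<noteq> 0" "u1 = 0" "u2 = 0" "u3 = 0"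
      | "v3 \<noteq> 0" "u1 = 0" "u2 = 0" "u3 = 0"
      | "u1 = 0" "u2 = 0" "u3 = 0" "v1 = 0" "v2 = 0" "v3 = 0" by blast
    then show ?thesis
    proof cases
      case 1
      then have "?P u2 (- u1) 0" using dep by (auto simp: mult.commute)
      then show ?thesis by blast
    next
      case 2
      then have "?P u3 0 (- u1)" using dep by (auto simp: mult.commute)
      then show ?thesis by blast
    next
      case 3
      then have "?P v2 (- v1) 0" by (auto simp: mult.commute)
      then show ?thesis by blast
    next
      case 4
      then have "?P v3 0 (- v1)" by (auto simp: mult.commute)
      then show ?thesis by blast
    next
      case 5
      then have "?P 1 0 0" by simp
      then show ?thesis by blast
    qed
  qed
qed

context
  fixes q n :: nat and ty :: "'a::{field,finite} itself"
  assumes primepow: "primepow q" and n_pos: "n > 0" and card_field: "CARD('a) = q ^ n"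
begin

lemma q_gt_1: "q > 1"
  using primepow by (rule primepow_gt_Suc_0[unfolded One_nat_def[symmetric]])

lemma prime_CHAR: "prime CHAR('a)"
  by (intro prime_CHAR_semidom finite_imp_CHAR_pos finite)

lemma q_eq_CHAR_power: "\<exists>k>0. q = CHAR('a) ^ k"
proof -
  obtain p k where pk: "prime p" "k > 0" "q = p ^ k"
    using primepow by (auto simp: primepow_def)
  have "CHAR('a) dvd p ^ (k * n)"
    using CHAR_dvd_CARD[where ?'a = 'a] card_field pk by (simp add: power_mult)
  then have "CHAR('a) dvd p" using prime_CHAR prime_dvd_power_nat by blast
  then have "CHAR('a) = p" using prime_CHAR pk(1) primes_dvd_imp_eq by blast
  with pk show ?thesis by blast
qed

lemma frobenius_add: "(x + y :: 'a) ^ (q ^ s) = x ^ (q ^ s) + y ^ (q ^ s)"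
proof -
  obtain k where "q = CHAR('a) ^ k" using q_eq_CHAR_power by blast
  then have "q ^ s = CHAR('a) ^ (k * s)" by (simp add: power_mult)
  then show ?thesis by (rule freshmans_dream'[OF prime_CHAR])
qed

lemma vanishing_prime_dvd_q: "of_nat m = (0 :: 'a) \<Longrightarrow> prime m \<Longrightarrow> m dvd q"
proof -
  assume m: "of_nat m = (0 :: 'a)" "prime m"
  then have "CHAR('a) dvd m" by (simp add: of_nat_eq_0_iff_char_dvd)
  then have "CHAR('a) = m" using prime_CHAR m(2) primes_dvd_imp_eq by blast
  then show "m dvd q" using q_eq_CHAR_power by (metis dvd_power)
qed

lemma power_card_multiple: "(x :: 'a) ^ (q ^ (n * k)) = x"
proof (induction k)
  case (Suc k)
  have "x ^ (q ^ (n * Suc k)) = (x ^ (q ^ n)) ^ (q ^ (n * k))"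
    by (simp add: power_add flip: power_mult)
  also have "x ^ (q ^ n) = x" using finite_field_power_card[of x] by (simp add: card_field)
  finally show ?case using Suc by simp
qed simp

lemma power_iterate: "(x :: 'a) ^ (q ^ s) = x \<Longrightarrow> x ^ (q ^ (s * k)) = x"
  by (induction k) (simp_all add: power_add power_mult)

lemma power_mod_n: "(x :: 'a) ^ (q ^ k) = x ^ (q ^ (k mod n))"
proof -
  have "x ^ (q ^ k) = (x ^ (q ^ (k mod n))) ^ (q ^ (n * (k div n)))"
    by (simp flip: power_mult power_add)
  then show ?thesis by (simp only: power_card_multiple)
qed

text \<open>
  The exponent \<open>s\<close> is invertible modulo \<open>n\<close>, so the \<open>q\<close>-power map is an iterate of the
  \<open>q ^ s\<close>-power map on the field.
\<close>

lemma frobenius_fixed_iff: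
  assumes "gcd s n = 1" and "s > 0"
  shows "(x :: 'a) ^ (q ^ s) = x \<longleftrightarrow> x ^ q = x"
proof
  assume x: "x ^ (q ^ s) = x"
  obtain u v where uv: "s * u = n * v + 1"
    using bezout_nat[of s n] assms by auto
  have "x = x ^ (q ^ (s * u))" using power_iterate[OF x] by simp
  also have "\<dots> = (x ^ (q ^ (n * v))) ^ q" by (simp add: uv mult.commute flip: power_mult)
  finally show "x ^ q = x" by (simp add: power_card_multiple)
next
  assume "x ^ q = x"
  then show "x ^ (q ^ s) = x" using power_iterate[of x 1 s] by simp
qed

text \<open>
  The power map with exponent \<open>(q ^ n - 1) / (q - 1)\<close> sends nonzero elements to roots of
  \<open>x ^ (q - 1) = 1\<close>, with fibres no larger than the exponent. This gives at least \<open>q - 1\<close> nonzero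
  fixed elements; there are at most \<open>q - 1\<close>, as roots of a polynomial.
\<close>

lemma card_frobenius_fixed: "card {x :: 'a. x ^ q = x} = q"
proof -
  let ?R = "{x :: 'a. x ^ (q - 1) = 1}"
  define M where "M = (q ^ n - 1) div (q - 1)"
  have M: "M * (q - 1) = q ^ n - 1" unfolding M_def using pred_dvd_power_pred by simp
  have "q ^ n > 1" using q_gt_1 n_pos by (rule one_less_power)
  then have M_pos: "M > 0" using M by (cases "M = 0") auto
  have root: "x ^ (M * (q - 1)) = 1" if "x \<noteq> 0" for x :: 'a
  proof -
    have "x * x ^ (q ^ n - 1) = x ^ (q ^ n)" using q_gt_1 power_minus_mult[of "q ^ n" x]
      by (simp add: mult.commute)
    also have "\<dots> = x * 1" using power_card_multiple[of x 1] by simp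
    finally show ?thesis using that by (simp only: M mult_cancel_left) simp
  qed
  have "card (UNIV - {0 :: 'a}) \<le> card ?R * M"
  proof (rule card_le_image_times_fibre)
    show "(\<lambda>x. x ^ M) ` (UNIV - {0}) \<subseteq> ?R" using root by (auto simp flip: power_mult)
    fix b :: 'a
    have "card {x \<in> UNIV - {0}. x ^ M = b} \<le> card {x. x ^ M = b}" by (rule card_mono) auto
    then show "card {x \<in> UNIV - {0}. x ^ M = b} \<le> M" using card_roots_power_le[OF M_pos, of b] by linarith
  qed auto
  moreover have "card (UNIV - {0 :: 'a}) = q ^ n - 1" by (simp add: card_field card_Diff_subset)
  ultimately have "M * (q - 1) \<le> M * card ?R" by (simp only: M mult.commute)
  then have "q - 1 \<le> card ?R" using M_pos by simp
  moreover have "card ?R \<le> q - 1" using q_gt_1 by (intro card_roots_power_le) simp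
  ultimately have "card ?R = q - 1" by simp
  moreover have "{x :: 'a. x ^ q = x} = insert 0 ?R"
  proof -
    have "x ^ q = x \<longleftrightarrow> x = 0 \<or> x ^ (q - 1) = 1" for x :: 'a
      using q_gt_1 by (cases q) auto
    then show ?thesis by auto
  qed
  moreover have "0 \<notin> ?R" using q_gt_1 by (simp add: zero_power)
  ultimately show ?thesis using q_gt_1 by simp
qed

lemma frobenius_field_automorphism:
  assumes "gcd s n = 1" and "s > 0"
  shows "field_automorphism (\<lambda>x :: 'a. x ^ (q ^ s)) q"
proof
  show "card {x :: 'a. x ^ (q ^ s) = x} = q" by (simp add: frobenius_fixed_iff[OF assms] card_frobenius_fixed)
qed (simp_all add: frobenius_add power_mult_distrib)

lemma frobenius_funpow: "((\<lambda>x :: 'a. x ^ (q ^ s)) ^^ k) x = x ^ (q ^ (s * k))"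
  by (induction k) (simp_all add: power_add mult.commute flip: power_mult)

text \<open>
  Multiplication by \<open>s\<close> permutes the residues modulo \<open>n\<close>, so the iterates of the \<open>q ^ s\<close>-power map
  run through the same conjugates in another order.
\<close>

lemma field_norm_frobenius:
  assumes "gcd s n = 1"
  shows "(\<Prod>i<n. ((\<lambda>x :: 'a. x ^ (q ^ s)) ^^ i) x) = field_norm q n x"
proof -
  have inj: "inj_on (\<lambda>i. s * i mod n) {..<n}"
  proof (rule inj_onI)
    fix i j assume ij: "i \<in> {..<n}" "j \<in> {..<n}" "s * i mod n = s * j mod n"
    then have "[i = j] (mod n)" using assms cong_mult_lcancel_nat[of s n i j]
      by (simp add: cong_def coprime_iff_gcd_eq_1)
    with ij show "i = j" by (simp add: cong_def)
  qed
  have "(\<lambda>i. s * i mod n) ` {..<n} \<subseteq> {..<n}" using n_pos by auto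
  then have "bij_betw (\<lambda>i. s * i mod n) {..<n} {..<n}"
    using inj endo_inj_surj[OF finite_lessThan] by (simp add: bij_betw_def)
  then have "(\<Prod>i<n. x ^ (q ^ (s * i mod n))) = (\<Prod>i<n. x ^ (q ^ i))"
    by (rule prod.reindex_bij_betw)
  then show ?thesis by (simp add: field_norm_def frobenius_funpow flip: power_mod_n)
qed

section \<open>Admissible triples\<close>

text \<open>
  This is the maximum rank distance property of the four families: a nonzero combination has rank
  at least \<open>n - 2\<close>. Type 1 has degree 2 in the Frobenius power. For type 2, more than \<open>q\<^sup>2\<close>
  roots would force the norm of \<open>- 1 / \<delta>\<close> to be 1, which the hypothesis on \<open>\<delta>\<close> excludes.
  Types 3 and 4 are the trinomials of period 7 and 8; an odd \<open>q\<close> gives \<open>2 \<noteq> 0\<close>, and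
  \<open>q mod 3 = 1\<close> gives \<open>3 \<noteq> 0\<close> and puts the cube roots of unity into the fixed field.
\<close>

lemma card_kernel_admissible:
  assumes "admissible_triple q n f1 f2 f3" and nz: "a \<noteq> 0 \<or> b \<noteq> 0 \<or> c \<noteq> 0"
  shows "card {x :: 'a. a * f1 x + b * f2 x + c * f3 x = 0} \<le> q\<^sup>2"
  using assms(1)
proof cases
  case (type1 s)
  interpret field_automorphism "\<lambda>x :: 'a. x ^ (q ^ s)" q
    by (rule frobenius_field_automorphism) (use type1 in auto)
  show ?thesis using card_kernel_degree_2[OF nz]
    by (simp add: type1 mult_2 power_add power_mult)
next
  case (type2 s \<delta>)
  let ?\<sigma> = "\<lambda>x :: 'a. x ^ (q ^ s)"
  interpret field_automorphism ?\<sigma> q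
    by (rule frobenius_field_automorphism) (use type2 in auto)
  have pow: "x ^ (q ^ (2 * s)) = ?\<sigma> (?\<sigma> x)" "x ^ (q ^ (3 * s)) = ?\<sigma> (?\<sigma> (?\<sigma> x))" for x :: 'a
    by (simp_all add: numeral_eq_Suc power_add power_mult)
  let ?W = "{x. a * ?\<sigma> x + b * ?\<sigma> (?\<sigma> x) + c * (x + \<delta> * ?\<sigma> (?\<sigma> (?\<sigma> x))) = 0}"
  have "card ?W \<le> q\<^sup>2"
  proof (cases "c = 0 \<or> \<delta> = 0")
    case True
    then have "?W = {x. c * x + a * ?\<sigma> x + b * ?\<sigma> (?\<sigma> x) = 0}" by (auto simp: algebra_simps)
    moreover have "c \<noteq> 0 \<or> a \<noteq> 0 \<or> b \<noteq> 0" using nz by blast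
    ultimately show ?thesis using card_kernel_degree_2[of c a b] by simp
  next
    case False
    show ?thesis
    proof (rule ccontr)
      assume "\<not> card ?W \<le> q\<^sup>2"
      then have large: "card ?W > q\<^sup>2" by simp
      have rec: "?\<sigma> (?\<sigma> (?\<sigma> x)) = - 1 / \<delta> * x + - a / (c * \<delta>) * ?\<sigma> x + - b / (c * \<delta>) * ?\<sigma> (?\<sigma> x)"
        if "x \<in> ?W" for x
      proof -
        have "c * \<delta> * ?\<sigma> (?\<sigma> (?\<sigma> x)) = - (c * x + a * ?\<sigma> x + b * ?\<sigma> (?\<sigma> x))"
          using that by (simp only: eq_neg_iff_add_eq_0) (simp add: algebra_simps)
        then have "?\<sigma> (?\<sigma> (?\<sigma> x)) = - (c * x + a * ?\<sigma> x + b * ?\<sigma> (?\<sigma> x)) / (c * \<delta>)"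
          using False by (metis mult_eq_0_iff nonzero_mult_div_cancel_left)
        also have "\<dots> = - 1 / \<delta> * x + - a / (c * \<delta>) * ?\<sigma> x + - b / (c * \<delta>) * ?\<sigma> (?\<sigma> x)"
          using False by (simp add: field_simps)
        finally show ?thesis .
      qed
      have "(\<Prod>i<n. (?\<sigma> ^^ i) (- 1 / \<delta>)) = 1"
        by (rule norm_eq_1_of_large_kernel[OF _ large rec])
          (simp_all add: frobenius_funpow power_card_multiple mult.commute)
      then have norm: "field_norm q n (- 1 / \<delta>) = 1"
        using field_norm_frobenius[of s] type2 by simp
      have "field_norm q n (- 1 / \<delta>) * field_norm q n \<delta> = field_norm q n (- 1)"
        using False by (simp add: field_norm_def flip: prod.distrib power_mult_distrib)
      also have "field_norm q n (- 1) = (- 1 :: 'a) ^ n"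
      proof -
        have "(- 1 :: 'a) ^ (q ^ i) = - 1" for i
        proof -
          have "(- 1 :: 'a) ^ (q ^ i) + 1 = (- 1 + 1) ^ (q ^ i)" by (simp only: frobenius_add) simp
          also have "\<dots> = 0" using q_gt_1 by simp
          finally show ?thesis by (simp add: eq_neg_iff_add_eq_0)
        qed
        then show ?thesis by (simp add: field_norm_def)
      qed
      also have "\<dots> = (- 1) ^ (3 * n)" by (simp add: power_mult power3_eq_cube)
      finally show False using type2 norm by simp
    qed
  qed
  then show ?thesis by (simp add: type2 pow)
next
  case (type3 s)
  let ?\<sigma> = "\<lambda>x :: 'a. x ^ (q ^ s)"
  interpret field_automorphism ?\<sigma> q
    by (rule frobenius_field_automorphism) (use type3 in auto)
  have "(2 :: 'a) \<noteq> 0" using vanishing_prime_dvd_q[of 2] type3(5) by auto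
  then have "card {x. a * x + b * ?\<sigma> x + c * ?\<sigma> (?\<sigma> (?\<sigma> x)) = 0} \<le> q\<^sup>2"
    using nz type3 power_card_multiple[of _ s]
    by (intro card_kernel_trinomial_7) (simp_all add: frobenius_funpow mult.commute)
  then show ?thesis by (simp add: type3 numeral_eq_Suc power_add power_mult)
next
  case (type4 s)
  let ?\<sigma> = "\<lambda>x :: 'a. x ^ (q ^ s)"
  interpret field_automorphism ?\<sigma> q
    by (rule frobenius_field_automorphism) (use type4 in auto)
  have three: "(3 :: 'a) \<noteq> 0" using vanishing_prime_dvd_q[of 3] type4(5) by auto
  have "[q ^ s = 1 ^ s] (mod 3)" by (rule cong_pow) (use type4 in \<open>simp add: cong_def\<close>)
  then have "q ^ s mod 3 = 1" by (simp add: cong_def)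
  then obtain m where m: "q ^ s = 3 * m + 1" by (metis mult_div_mod_eq)
  have "?\<sigma> w = w" if "w ^ 3 = 1" for w using that by (simp add: m power_add power_mult)
  then have "card {x. a * x + b * ?\<sigma> x + c * ?\<sigma> (?\<sigma> (?\<sigma> x)) = 0} \<le> q\<^sup>2"
    using nz three type4 power_card_multiple[of _ s]
    by (intro card_kernel_trinomial_8) (simp_all add: frobenius_funpow mult.commute)
  then show ?thesis by (simp add: type4 numeral_eq_Suc power_add power_mult)
qed

lemma admissible_q_linear:
  assumes "admissible_triple q n f1 f2 f3" and "f \<in> {f1, f2, f3}"
  shows "f (x + y :: 'a) = f x + f y" and "c ^ q = c \<Longrightarrow> f (c * x) = c * f x"
proof -
  have add: "(x ^ (q ^ k) + y ^ (q ^ k)) = (x + y) ^ (q ^ k)" for k by (simp add: frobenius_add)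
  from assms show "f (x + y) = f x + f y"
    by (elim admissible_triple.cases) (auto simp: add[symmetric] algebra_simps)
  have scale: "c ^ (q ^ k) = c" if "c ^ q = c" for k
    using power_iterate[of c 1 k] that by simp
  from assms show "f (c * x) = c * f x" if "c ^ q = c"
    by (elim admissible_triple.cases)
      (auto simp: power_mult_distrib scale[OF that] algebra_simps)
qed

lemma combination_q_linear:
  assumes adm: "admissible_triple q n f1 f2 f3"
  shows "a * f1 (x + y :: 'a) + b * f2 (x + y) + c * f3 (x + y)
      = (a * f1 x + b * f2 x + c * f3 x) + (a * f1 y + b * f2 y + c * f3 y)"
    and "d ^ q = d \<Longrightarrow> a * f1 (d * x) + b * f2 (d * x) + c * f3 (d * x)
      = d * (a * f1 x + b * f2 x + c * f3 x)"
  using admissible_q_linear(1)[OF adm, of f1 x y] admissible_q_linear(1)[OF adm, of f2 x y]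
    admissible_q_linear(1)[OF adm, of f3 x y] admissible_q_linear(2)[OF adm, of f1 d x]
    admissible_q_linear(2)[OF adm, of f2 d x] admissible_q_linear(2)[OF adm, of f3 d x]
  by (simp_all add: algebra_simps)

lemma admissible_inj:
  assumes "admissible_triple q n f1 f2 f3"
  shows "inj (f1 :: 'a \<Rightarrow> 'a)"
  using assms
proof cases
  case (type2 s)
  interpret field_automorphism "\<lambda>x :: 'a. x ^ (q ^ s)" q
    by (rule frobenius_field_automorphism) (use type2 in auto)
  show ?thesis using inj_hom by (simp add: type2)
qed simp_all

lemma admissible_card_equal:
  assumes "admissible_triple q n f1 f2 f3"
  shows "card {x :: 'a. f2 x = f1 x} = q"
  using assms
proof cases
  case (type2 s)
  interpret field_automorphism "\<lambda>x :: 'a. x ^ (q ^ s)" q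
    by (rule frobenius_field_automorphism) (use type2 in auto)
  have "f2 x = f1 x \<longleftrightarrow> x ^ q = x" for x
  proof -
    have "f2 x = f1 x \<longleftrightarrow> (x ^ (q ^ s)) ^ (q ^ s) = x ^ (q ^ s)"
      by (simp add: type2 mult_2 power_add power_mult)
    also have "\<dots> \<longleftrightarrow> x ^ (q ^ s) = x" by (rule inj_eq[OF inj_hom])
    also have "\<dots> \<longleftrightarrow> x ^ q = x" by (rule frobenius_fixed_iff) (use type2 in auto)
    finally show ?thesis .
  qed
  then show ?thesis by (simp add: card_frobenius_fixed)
qed (use frobenius_fixed_iff card_frobenius_fixed in simp_all)

lemma card_q_subspace:
  assumes "(0 :: 'a) \<in> S" and "\<And>x y. x \<in> S \<Longrightarrow> y \<in> S \<Longrightarrow> x + y \<in> S"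
    and "\<And>c x. c ^ q = c \<Longrightarrow> x \<in> S \<Longrightarrow> c * x \<in> S"
  shows "\<exists>k. card S = q ^ k"
proof -
  interpret field_automorphism "\<lambda>x :: 'a. x ^ (q ^ 1)" q
    by (rule frobenius_field_automorphism) auto
  have "fixed_subspace S" unfolding fixed_subspace_def using assms by auto
  then show ?thesis by (rule card_fixed_subspace)
qed

lemma card_range_times_card_kernel:
  fixes g :: "'a \<Rightarrow> 'a"
  assumes "\<And>x y. g (x + y) = g x + g y"
  shows "card (range g) * card {x. g x = 0} = q ^ n"
proof -
  have "card {x \<in> UNIV. g x = g a} = card {x. g x = 0}" for a
  proof -
    have "bij_betw (\<lambda>x. x + a) {x. g x = 0} {x \<in> UNIV. g x = g a}"
    proof (rule bij_betw_byWitness[where f' = "\<lambda>x. x - a"])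
      have "g (x - a) = 0" if "g x = g a" for x
        using assms[of "x - a" a] that by simp
      then show "(\<lambda>x. x - a) ` {x \<in> UNIV. g x = g a} \<subseteq> {x. g x = 0}" by auto
    qed (auto simp: assms)
    then show ?thesis by (rule bij_betw_same_card[symmetric])
  qed
  then have "card (UNIV :: 'a set) = card (range g) * card {x. g x = 0}"
    by (intro card_eq_image_times_fibre) auto
  then show ?thesis by (simp add: card_field)
qed

text \<open>
  Vanishing at 1 and at some \<open>w\<close> outside the field of order \<open>q\<close> imposes two linear conditions on
  three coefficients. The roots then contain the plane spanned by 1 and \<open>w\<close> over that field, and
  the upper bound excludes further ones.
\<close>

lemma ex_two_dimensional_kernel:
  assumes "n \<ge> 2" and adm: "admissible_triple q n f1 f2 f3"
  shows "\<exists>a b c :: 'a. (a \<noteq> 0 \<or> b \<noteq> 0 \<or> c \<noteq> 0) \<and>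
    card {x. a * f1 x + b * f2 x + c * f3 x = 0} = q\<^sup>2"
proof -
  let ?F = "{x :: 'a. x ^ q = x}"
  have "card ?F < card (UNIV :: 'a set)"
    using assms(1) q_gt_1 power_strict_increasing[of 1 n q] by (simp add: card_frobenius_fixed card_field)
  then have "?F \<noteq> UNIV" by auto
  then obtain w :: 'a where w: "w ^ q \<noteq> w" by auto
  obtain a b c where abc: "a \<noteq> 0 \<or> b \<noteq> 0 \<or> c \<noteq> 0"
      "a * f1 1 + b * f2 1 + c * f3 1 = 0" "a * f1 w + b * f2 w + c * f3 w = 0"
    using ex_orthogonal_to_two[of "f1 1" "f2 1" "f3 1" "f1 w" "f2 w" "f3 w"] by blast
  define g where "g x = a * f1 x + b * f2 x + c * f3 x" for x
  have g_add: "g (x + y) = g x + g y" for x y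
    unfolding g_def by (rule combination_q_linear(1)[OF adm])
  have g_scale: "g (d * x) = d * g x" if "d ^ q = d" for d x
    unfolding g_def by (rule combination_q_linear(2)[OF adm that])
  have F_diff: "(x - y) ^ q = x - y" if "x ^ q = x" "y ^ q = y" for x y :: 'a
    using frobenius_add[of "x - y" y 1] that
    by (metis add_diff_cancel_right' diff_add_cancel power_one_right)
  have "inj_on (\<lambda>(u, v). u + v * w) (?F \<times> ?F)"
  proof (rule inj_onI, clarify)
    fix u v u' v' :: 'a
    assume *: "u ^ q = u" "v ^ q = v" "u' ^ q = u'" "v' ^ q = v'" "u + v * w = u' + v' * w"
    have "v = v'"
    proof (rule ccontr)
      assume "v \<noteq> v'"
      have "(v - v') * w = u' - u" using *(5) by (simp add: algebra_simps)
      then have "w = (u' - u) / (v - v')" using \<open>v \<noteq> v'\<close> by (simp add: field_simps)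
      then show False using w * by (simp add: power_divide F_diff)
    qed
    with *(5) show "u = u' \<and> v = v'" by simp
  qed
  then have "q\<^sup>2 = card ((\<lambda>(u, v). u + v * w) ` (?F \<times> ?F))"
    by (simp add: card_image card_cartesian_product card_frobenius_fixed power2_eq_square)
  also have "\<dots> \<le> card {x. g x = 0}"
  proof (rule card_mono)
    have "g (u + v * w) = 0" if "u ^ q = u" "v ^ q = v" for u v
    proof -
      have "g u = u * g 1" using g_scale[OF that(1), of 1] by simp
      then show ?thesis using g_scale[OF that(2), of w] abc by (simp add: g_add) (simp add: g_def)
    qed
    then show "(\<lambda>(u, v). u + v * w) ` (?F \<times> ?F) \<subseteq> {x. g x = 0}" by auto
  qed simp
  finally have "card {x. g x = 0} = q\<^sup>2"
    using card_kernel_admissible[OF adm abc(1)] by (simp add: g_def)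
  with abc(1) show ?thesis by (auto simp: g_def)
qed

end

section \<open>Linear codes spanned by the rows of a matrix\<close>

text \<open>
  Injectivity of \<open>a \<mapsto> G\<^sup>T a\<close> contains both parts of the claim that the rows form a basis: a
  repeated row is a relation between two unit vectors, and a dependence between distinct rows is
  a nonzero \<open>a\<close> in the kernel.
\<close>

lemma generator_matrix_of_injective:
  fixes G :: "'a::field mat"
  assumes G: "G \<in> carrier_mat k N"
    and inj: "\<And>a. a \<in> carrier_vec k \<Longrightarrow> G\<^sup>T *\<^sub>v a = 0\<^sub>v N \<Longrightarrow> a = 0\<^sub>v k"
  defines "C \<equiv> (\<lambda>a. G\<^sup>T *\<^sub>v a) ` carrier_vec k"
  shows "linear_code N k C" and "generator_matrix N k G C"
proof -
  interpret vec_space "TYPE('a)" N .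
  have rows_len: "length (rows G) = k" using G by simp
  have rows_sub: "set (rows G) \<subseteq> carrier_vec N" using G rows_carrier[of G] by auto
  have GT: "G\<^sup>T \<in> carrier_mat N k" using G by simp
  have distinct: "distinct (rows G)"
    unfolding distinct_conv_nth
  proof (intro allI impI notI)
    fix i j assume ij: "i < length (rows G)" "j < length (rows G)" "i \<noteq> j" "rows G ! i = rows G ! j"
    then have i: "i < k" and j: "j < k" using G by auto
    have row: "row G i = row G j" using ij i j G by (simp add: nth_rows)
    let ?a = "unit_vec k i - unit_vec k j :: 'a vec"
    have "G\<^sup>T *\<^sub>v ?a = 0\<^sub>v N"
    proof (rule eq_vecI)
      fix l assume "l < dim_vec (0\<^sub>v N :: 'a vec)"
      then have l: "l < N" by simp
      have "(G\<^sup>T *\<^sub>v ?a) $ l = row G\<^sup>T l \<bullet> unit_vec k i - row G\<^sup>T l \<bullet> unit_vec k j"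
        using l G by (simp add: scalar_prod_minus_distrib[of _ k])
      also have "\<dots> = row G i $ l - row G j $ l" using l i j G by simp
      finally show "(G\<^sup>T *\<^sub>v ?a) $ l = 0\<^sub>v N $ l" using row l by simp
    qed (use G in simp)
    then have "?a = 0\<^sub>v k" by (intro inj) auto
    then have "?a $ i = 0\<^sub>v k $ i" by simp
    then show False using i j ij(3) by simp
  qed
  have lincomb: "lincomb f (set (rows G)) = G\<^sup>T *\<^sub>v vec k (\<lambda>i. f (rows G ! i))" for f
  proof -
    have "lincomb f (set (rows G)) = lincomb_list (\<lambda>i. f (rows G ! i)) (rows G)"
      by (rule lincomb_as_lincomb_list_distinct[OF rows_sub distinct])
    also have "\<dots> = mat_of_cols N (rows G) *\<^sub>v vec (length (rows G)) (\<lambda>i. f (rows G ! i))"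
      by (rule lincomb_list_as_mat_mult) (use rows_sub in auto)
    also have "mat_of_cols N (rows G) = G\<^sup>T"
    proof -
      have "mat_of_rows N (rows G) = G" using mat_of_rows_rows[of G] carrier_matD(2)[OF G] by simp
      then show ?thesis using transpose_mat_of_rows[of N "rows G"] by simp
    qed
    finally show ?thesis using rows_len by simp
  qed
  have indpt: "\<not> lin_dep (set (rows G))"
  proof
    assume "lin_dep (set (rows G))"
    then obtain f v where f: "lincomb f (set (rows G)) = 0\<^sub>v N" "v \<in> set (rows G)" "f v \<noteq> 0"
      using finite_lin_dep[of "set (rows G)"] rows_sub by auto
    then have "vec k (\<lambda>i. f (rows G ! i)) = 0\<^sub>v k" using lincomb by (intro inj) auto
    moreover obtain i where "i < k" "v = rows G ! i"
      using f(2) rows_len by (metis in_set_conv_nth)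
    ultimately show False using f(3) by (metis index_vec index_zero_vec(1))
  qed
  have C_span: "C = span (set (rows G))"
  proof -
    have "row_space G = C" unfolding row_space_eq[OF G] C_def using G by auto
    then show ?thesis by (simp add: row_space_def)
  qed
  have sub: "VectorSpace.subspace class_ring C V"
    unfolding C_span by (rule span_is_subspace) (use rows_sub in auto)
  have submod: "submodule class_ring C V" using sub by (simp add: subspace_def)
  have vs: "vectorspace class_ring (vs C)" by (rule subspace_is_vs[OF sub])
  have rows_C: "set (rows G) \<subseteq> C" unfolding C_span using rows_sub by (rule in_own_span)
  have basis: "vectorspace.basis class_ring (vs C) (set (rows G))"
    unfolding vectorspace.basis_def[OF vs]
    using span_li_not_depend[OF rows_C submod] indpt rows_C C_span by simp
  then show "generator_matrix N k G C"
    using G distinct by (simp add: generator_matrix_def)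
  have "vectorspace.dim class_ring (vs C) = card (set (rows G))"
    by (rule vectorspace.dim_basis[OF vs _ basis]) simp
  then show "linear_code N k C"
    using sub distinct_card[OF distinct] rows_len by (simp add: linear_code_def)
qed

section \<open>Counting points\<close>

lemma proj_point_eq:
  fixes v :: "'a::field vec"
  shows "proj_point v = {c \<cdot>\<^sub>v v | c. True}"
proof -
  interpret vec_space "TYPE('a)" "dim_vec v" .
  have v: "v \<in> carrier_vec (dim_vec v)" by simp
  have *: "lincomb f {v} = f v \<cdot>\<^sub>v v" for f
    unfolding lincomb_def using v by simp
  have "span {v} = {w. \<exists>f. w = lincomb f {v}}"
    by (rule finite_span) simp_all
  also have "\<dots> = {c \<cdot>\<^sub>v v | c. True}"
  proof (intro equalityI subsetI)
    fix w assume "w \<in> {c \<cdot>\<^sub>v v | c. True}"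
    then obtain c where "w = c \<cdot>\<^sub>v v" by blast
    then have "w = lincomb (\<lambda>_. c) {v}" by (simp only: *)
    then show "w \<in> {w. \<exists>f. w = lincomb f {v}}" by blast
  qed (auto simp only: *)
  finally have "span {v} = {c \<cdot>\<^sub>v v | c. True}" .
  then show ?thesis by (simp add: proj_point_def)
qed

lemma proj_point_eq_iff:
  fixes u v :: "'a::field vec"
  assumes "u \<in> carrier_vec m" "u \<noteq> 0\<^sub>v m"
  shows "proj_point u = proj_point v \<longleftrightarrow> (\<exists>c. u = c \<cdot>\<^sub>v v)"
proof
  assume "proj_point u = proj_point v"
  moreover have "u \<in> proj_point u" unfolding proj_point_eq by (auto intro: exI[of _ 1])
  ultimately show "\<exists>c. u = c \<cdot>\<^sub>v v" by (auto simp: proj_point_eq)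
next
  assume "\<exists>c. u = c \<cdot>\<^sub>v v"
  then obtain c where c: "u = c \<cdot>\<^sub>v v" by blast
  have "c \<noteq> 0" using assms c by auto
  have "d \<cdot>\<^sub>v v = (d / c) \<cdot>\<^sub>v u" for d using \<open>c \<noteq> 0\<close> by (simp add: c smult_smult_assoc)
  moreover have "d \<cdot>\<^sub>v u = (d * c) \<cdot>\<^sub>v v" for d by (simp add: c smult_smult_assoc)
  ultimately show "proj_point u = proj_point v" unfolding proj_point_eq by blast
qed

text \<open>
  Each point defined by \<open>U\<close> contains at least the \<open>q - 1\<close> multiples of one of its vectors by
  scalars with \<open>c ^ q = c\<close>. As there are \<open>N\<close> points and \<open>U\<close> has at most \<open>N * (q - 1)\<close> nonzero vectors, every
  inequality is an equality: \<open>U\<close> has the maximal order \<open>M\<close>, and each point carries exactly \<open>q - 1\<close> vectors. So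
  the columns of \<open>G\<close> orthogonal to \<open>a\<close> count the vectors of \<open>U\<close> orthogonal to \<open>a\<close>.
\<close>

lemma points_partition:
  fixes U :: "'a::{field,finite} vec set" and G :: "'a mat"
  assumes U: "finite U" "U \<subseteq> carrier_vec m" "0\<^sub>v m \<in> U"
    and scale: "\<And>c u. c ^ q = c \<Longrightarrow> u \<in> U \<Longrightarrow> c \<cdot>\<^sub>v u \<in> U"
    and F: "card {c :: 'a. c ^ q = c} = q" and "q > 0"
    and G: "G \<in> carrier_mat m N" and cols: "columns_one_per_point G (U - {0\<^sub>v m})"
    and N: "N * (q - 1) = M - 1" and "card U \<le> M"
  shows "card U = M"
    and "a \<in> carrier_vec m \<Longrightarrow>
      card {j. j < N \<and> col G j \<bullet> a = 0} * (q - 1) + 1 = card {u \<in> U. u \<bullet> a = 0}"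
proof -
  let ?U = "U - {0\<^sub>v m}"
  let ?fib = "\<lambda>P. {u \<in> ?U. proj_point u = P}"
  have bij: "bij_betw (\<lambda>j. proj_point (col G j)) {..<N} (proj_point ` ?U)"
    and cols_U: "set (cols G) \<subseteq> ?U"
    using cols G by (auto simp: columns_one_per_point_def)
  have card_points: "card (proj_point ` ?U) = N"
    using bij_betw_same_card[OF bij] by simp
  have fin: "finite ?U" using U by simp
  have ge: "q - 1 \<le> card (?fib P)" if P: "P \<in> proj_point ` ?U" for P
  proof -
    obtain u where u: "u \<in> U" "u \<noteq> 0\<^sub>v m" "P = proj_point u" using P by blast
    have um: "u \<in> carrier_vec m" using u U by auto
    then obtain i where i: "i < m" "u $ i \<noteq> 0"
      using u(2) by (metis carrier_vecD eq_vecI index_zero_vec)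
    have "(\<lambda>c. c \<cdot>\<^sub>v u) ` ({c. c ^ q = c} - {0}) \<subseteq> ?fib P"
    proof (rule image_subsetI)
      fix c :: 'a assume "c \<in> {c. c ^ q = c} - {0}"
      then have c: "c ^ q = c" "c \<noteq> 0" by auto
      have "(c \<cdot>\<^sub>v u) $ i \<noteq> 0\<^sub>v m $ i" using c i um by simp
      then have nz: "c \<cdot>\<^sub>v u \<noteq> 0\<^sub>v m" by metis
      then show "c \<cdot>\<^sub>v u \<in> ?fib P"
        using scale[OF c(1) u(1)] um proj_point_eq_iff[of "c \<cdot>\<^sub>v u" m u] by (auto simp: u(3))
    qed
    moreover have "inj_on (\<lambda>c. c \<cdot>\<^sub>v u) ({c. c ^ q = c} - {0})"
    proof (rule inj_onI)
      fix c d assume "c \<cdot>\<^sub>v u = d \<cdot>\<^sub>v u"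
      then have "(c \<cdot>\<^sub>v u) $ i = (d \<cdot>\<^sub>v u) $ i" by simp
      then show "c = d" using i um by simp
    qed
    ultimately have "card ({c :: 'a. c ^ q = c} - {0}) \<le> card (?fib P)"
      using fin by (intro card_inj_on_le) auto
    moreover have "card ({c :: 'a. c ^ q = c} - {0}) = q - 1"
      using F \<open>q > 0\<close> by (subst card_Diff_singleton) (auto simp: zero_power)
    ultimately show ?thesis by simp
  qed
  have sum: "card ?U = (\<Sum>P\<in>proj_point ` ?U. card (?fib P))"
    by (rule card_eq_sum_card_fibres[OF fin])
  have card_U: "card ?U = card U - 1" using U by (simp add: card_Diff_singleton)
  have U_pos: "card U > 0" using U by (auto simp: card_gt_0_iff)
  have "N * (q - 1) = (\<Sum>P\<in>proj_point ` ?U. q - 1)" by (simp add: card_points)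
  also have "\<dots> \<le> card ?U" unfolding sum by (rule sum_mono) (rule ge)
  finally have "M - 1 \<le> card U - 1" using N card_U by simp
  then show card_M: "card U = M" using U_pos assms(10) by linarith
  have fib: "card (?fib P) = q - 1" if "P \<in> proj_point ` ?U" for P
  proof -
    have "(\<Sum>P\<in>proj_point ` ?U. q - 1) = (\<Sum>P\<in>proj_point ` ?U. card (?fib P))"
      using card_points card_M card_U N sum by simp
    from sum_mono_inv[OF this ge that] fin show ?thesis by simp
  qed
  show "card {j. j < N \<and> col G j \<bullet> a = 0} * (q - 1) + 1 = card {u \<in> U. u \<bullet> a = 0}"
    if a: "a \<in> carrier_vec m"
  proof -
    let ?K = "{u \<in> ?U. u \<bullet> a = 0}"
    have perp: "u \<bullet> a = 0" if "proj_point u = proj_point v" "v \<bullet> a = 0" "u \<in> ?U" "v \<in> ?U" for u v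
    proof -
      have "u \<in> carrier_vec m" "u \<noteq> 0\<^sub>v m" "v \<in> carrier_vec m" using that U by auto
      then show ?thesis using that(1,2) proj_point_eq_iff[of u m v] a by auto
    qed
    have col_U: "col G j \<in> ?U" if "j < N" for j
      using cols_U that G by (metis carrier_matD(2) cols_length cols_nth nth_mem subsetD)
    have image: "(\<lambda>j. proj_point (col G j)) ` {j. j < N \<and> col G j \<bullet> a = 0} = proj_point ` ?K"
    proof (intro equalityI subsetI)
      fix P assume "P \<in> proj_point ` ?K"
      then obtain u where u: "u \<in> ?U" "u \<bullet> a = 0" "P = proj_point u" by auto
      then have "P \<in> (\<lambda>j. proj_point (col G j)) ` {..<N}" using bij by (auto simp: bij_betw_def)
      then obtain j where "j < N" "P = proj_point (col G j)" by auto
      with u perp[of "col G j" u] col_U show "P \<in> (\<lambda>j. proj_point (col G j)) ` {j. j < N \<and> col G j \<bullet> a = 0}"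
        by auto
    qed (use col_U in auto)
    have "inj_on (\<lambda>j. proj_point (col G j)) {j. j < N \<and> col G j \<bullet> a = 0}"
      using bij by (auto simp: bij_betw_def intro: inj_on_subset)
    then have Z: "card {j. j < N \<and> col G j \<bullet> a = 0} = card (proj_point ` ?K)"
      unfolding image[symmetric] by (rule card_image[symmetric])
    have "card {x \<in> ?K. proj_point x = proj_point u} = q - 1" if "u \<in> ?K" for u
    proof -
      have "x \<bullet> a = 0" if "x \<in> ?U" "proj_point x = proj_point u" for x
        using perp[OF that(2)] that(1) \<open>u \<in> ?K\<close> by simp
      then have "{x \<in> ?K. proj_point x = proj_point u} = ?fib (proj_point u)" by auto
      then show ?thesis using fib[of "proj_point u"] \<open>u \<in> ?K\<close> by simp
    qed
    then have "card ?K = card (proj_point ` ?K) * (q - 1)"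
      using fin by (intro card_eq_image_times_fibre) auto
    moreover have "{u \<in> U. u \<bullet> a = 0} = insert (0\<^sub>v m) ?K" using U a by auto
    then have "card {u \<in> U. u \<bullet> a = 0} = Suc (card ?K)" using fin by simp
    ultimately show ?thesis using Z by simp
  qed
qed

section \<open>The vectors of a sum of triples\<close>

lemma triple_vec_eq:
  "triple_vec t f1 f2 f3 x = vec (3 * t) (\<lambda>i. [f1 (i div 3 + 1) (x (i div 3 + 1)),
      f2 (i div 3 + 1) (x (i div 3 + 1)), f3 (i div 3 + 1) (x (i div 3 + 1))] ! (i mod 3))"
proof -
  let ?h = "\<lambda>j. [f1 j (x j), f2 j (x j), f3 j (x j)]"
  define L where "L t = concat (map ?h [1..<t + 1])" for t
  have L_Suc: "L (Suc t) = L t @ ?h (t + 1)" for t by (simp add: L_def)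
  have len: "length (L t) = 3 * t" for t
    by (induction t) (simp_all add: L_Suc, simp add: L_def)
  have "L t ! i = ?h (i div 3 + 1) ! (i mod 3)" if "i < 3 * t" for i
    using that
  proof (induction t)
    case (Suc t)
    show ?case
    proof (cases "i < 3 * t")
      case True
      then show ?thesis using Suc.IH len[of t] by (simp add: L_Suc nth_append)
    next
      case False
      define r where "r = i - 3 * t"
      have r: "i = 3 * t + r" "r < 3" using False Suc.prems by (auto simp: r_def)
      then show ?thesis using len[of t] by (simp add: L_Suc nth_append)
    qed
  qed simp
  moreover have "triple_vec t f1 f2 f3 x = vec_of_list (L t)"
    unfolding triple_vec_def L_def ..
  ultimately show ?thesis using len[of t] by (intro eq_vecI) (simp_all add: vec_of_list_index)
qed

lemma triple_vec_carrier [simp]: "triple_vec t f1 f2 f3 x \<in> carrier_vec (3 * t)"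
  by (simp add: triple_vec_eq)

lemma triple_vec_scalar_prod:
  fixes f1 f2 f3 :: "nat \<Rightarrow> 'a::comm_semiring_0 \<Rightarrow> 'a"
  assumes "a \<in> carrier_vec (3 * t)"
  shows "triple_vec t f1 f2 f3 x \<bullet> a =
    (\<Sum>j<t. a $ (3 * j) * f1 (j + 1) (x (j + 1)) + a $ (3 * j + 1) * f2 (j + 1) (x (j + 1))
      + a $ (3 * j + 2) * f3 (j + 1) (x (j + 1)))"
proof -
  have "triple_vec t f1 f2 f3 x \<bullet> a = (\<Sum>i<t * 3. triple_vec t f1 f2 f3 x $ i * a $ i)"
    using assms by (simp add: scalar_prod_def lessThan_atLeast0 mult.commute)
  also have "\<dots> = (\<Sum>j<t. \<Sum>i = j * 3..<j * 3 + 3. triple_vec t f1 f2 f3 x $ i * a $ i)"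
    by (rule sum.nat_group[symmetric])
  also have "\<dots> = (\<Sum>j<t. a $ (3 * j) * f1 (j + 1) (x (j + 1)) + a $ (3 * j + 1) * f2 (j + 1) (x (j + 1))
      + a $ (3 * j + 2) * f3 (j + 1) (x (j + 1)))"
  proof (rule sum.cong[OF refl])
    fix j assume "j \<in> {..<t}"
    then have j: "j < t" by simp
    have "{j * 3..<j * 3 + 3} = {3 * j, 3 * j + 1, 3 * j + 2}" by auto
    moreover have "(3 * j + 1) div 3 = j" "(3 * j + 2) div 3 = j"
      "(3 * j + 1) mod 3 = 1" "(3 * j + 2) mod 3 = 2" by presburger+
    ultimately show "(\<Sum>i = j * 3..<j * 3 + 3. triple_vec t f1 f2 f3 x $ i * a $ i)
      = a $ (3 * j) * f1 (j + 1) (x (j + 1)) + a $ (3 * j + 1) * f2 (j + 1) (x (j + 1))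
      + a $ (3 * j + 2) * f3 (j + 1) (x (j + 1))"
      using j by (simp add: triple_vec_eq algebra_simps)
  qed
  finally show ?thesis .
qed

text \<open>
  The component functions are compared only at the arguments used, so that sums, differences and
  multiples of such vectors can first be written with constant component functions, as below, and
  then be recognised as vectors of the original triples.
\<close>

lemma triple_vec_cong:
  assumes "\<And>j. j \<in> {1..t} \<Longrightarrow> f1 j (x j) = g1 j (y j) \<and> f2 j (x j) = g2 j (y j) \<and> f3 j (x j) = g3 j (y j)"
  shows "triple_vec t f1 f2 f3 x = triple_vec t g1 g2 g3 y"
proof -
  have "map (\<lambda>j. [f1 j (x j), f2 j (x j), f3 j (x j)]) [1..<t + 1]
      = map (\<lambda>j. [g1 j (y j), g2 j (y j), g3 j (y j)]) [1..<t + 1]"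
    using assms by (intro map_cong) auto
  then show ?thesis by (simp only: triple_vec_def)
qed

lemma nth_3_cases:
  assumes "P 0" "P 1" "P 2"
  shows "P (i mod 3 :: nat)"
proof -
  have "i mod 3 = 0 \<or> i mod 3 = 1 \<or> i mod 3 = 2" by presburger
  then show ?thesis using assms by metis
qed

lemma triple_vec_add:
  "triple_vec t f1 f2 f3 x + triple_vec t f1 f2 f3 y =
    triple_vec t (\<lambda>j _. f1 j (x j) + f1 j (y j)) (\<lambda>j _. f2 j (x j) + f2 j (y j))
      (\<lambda>j _. f3 j (x j) + f3 j (y j)) z"
  by (rule eq_vecI) (simp_all add: triple_vec_eq, rule nth_3_cases, simp_all)

lemma triple_vec_diff:
  "triple_vec t f1 f2 f3 x - triple_vec t f1 f2 f3 y =
    triple_vec t (\<lambda>j _. f1 j (x j) - f1 j (y j)) (\<lambda>j _. f2 j (x j) - f2 j (y j))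
      (\<lambda>j _. f3 j (x j) - f3 j (y j)) z"
  by (rule eq_vecI) (simp_all add: triple_vec_eq, rule nth_3_cases, simp_all)

lemma triple_vec_smult:
  "c \<cdot>\<^sub>v triple_vec t f1 f2 f3 x =
    triple_vec t (\<lambda>j _. c * f1 j (x j)) (\<lambda>j _. c * f2 j (x j)) (\<lambda>j _. c * f3 j (x j)) z"
  by (rule eq_vecI) (simp_all add: triple_vec_eq, rule nth_3_cases, simp_all)

lemma card_image_times_card_perp:
  fixes U :: "'a::{field,finite} vec set"
  assumes U: "finite U" "U \<subseteq> carrier_vec m"
    and closed: "\<And>u v. u \<in> U \<Longrightarrow> v \<in> U \<Longrightarrow> u + v \<in> U" "\<And>u v. u \<in> U \<Longrightarrow> v \<in> U \<Longrightarrow> u - v \<in> U"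
    and a: "a \<in> carrier_vec m"
  shows "card U = card ((\<lambda>u. u \<bullet> a) ` U) * card {u \<in> U. u \<bullet> a = 0}"
proof (rule card_eq_image_times_fibre[OF U(1)])
  fix w assume w: "w \<in> U"
  have car: "u \<in> carrier_vec m" if "u \<in> U" for u using that U by auto
  have "bij_betw (\<lambda>u. u + w) {u \<in> U. u \<bullet> a = 0} {u \<in> U. u \<bullet> a = w \<bullet> a}"
  proof (rule bij_betw_byWitness[where f' = "\<lambda>u. u - w"])
    show "(\<lambda>u. u + w) ` {u \<in> U. u \<bullet> a = 0} \<subseteq> {u \<in> U. u \<bullet> a = w \<bullet> a}"
      using w closed car a by (auto simp: add_scalar_prod_distrib[of _ m])
    show "(\<lambda>u. u - w) ` {u \<in> U. u \<bullet> a = w \<bullet> a} \<subseteq> {u \<in> U. u \<bullet> a = 0}"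
      using w closed car a by (auto simp: minus_scalar_prod_distrib[of _ m])
    show "\<forall>u\<in>{u \<in> U. u \<bullet> a = 0}. u + w - w = u"
      using car w by (auto intro!: eq_vecI dest!: car)
    show "\<forall>u\<in>{u \<in> U. u \<bullet> a = w \<bullet> a}. u - w + w = u"
      using car w by (auto intro!: eq_vecI dest!: car)
  qed
  then show "card {u \<in> U. u \<bullet> a = w \<bullet> a} = card {u \<in> U. u \<bullet> a = 0}"
    by (rule bij_betw_same_card[symmetric])
qed

section \<open>Three-weight codes from triples\<close>

locale triple_code =
  fixes q n t N :: nat
    and f1 f2 f3 :: "nat \<Rightarrow> 'a::{field, finite} \<Rightarrow> 'a"
    and G :: "'a mat"
  assumes primepow: "primepow q"
    and n: "n \<ge> 3"
    and t: "t \<ge> 2"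
    and card_field: "CARD('a) = q ^ n"
    and N_eq: "N = (q ^ (n * t) - 1) div (q - 1)"
    and adm: "\<And>j. j \<in> {1..t} \<Longrightarrow> admissible_triple q n (f1 j) (f2 j) (f3 j)"
    and G: "G \<in> carrier_mat (3 * t) N"
    and cols: "columns_one_per_point G (range (triple_vec t f1 f2 f3) - {0\<^sub>v (3 * t)})"
begin

definition U :: "'a vec set" where "U = range (triple_vec t f1 f2 f3)"

text \<open>
  The contribution of block \<open>j + 1\<close> to \<open>u \<bullet> a\<close>: blocks are numbered from 1, coordinates
  from 0.
\<close>

definition component :: "'a vec \<Rightarrow> nat \<Rightarrow> 'a \<Rightarrow> 'a" where
  "component a j x = a $ (3 * j) * f1 (j + 1) x + a $ (3 * j + 1) * f2 (j + 1) x + a $ (3 * j + 2) * f3 (j + 1) x"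

definition dot_image :: "'a vec \<Rightarrow> 'a set" where "dot_image a = (\<lambda>u. u \<bullet> a) ` U"

lemma n_pos: "n > 0" using n by simp

lemmas field_facts = primepow n_pos card_field

lemma q_gt_1: "q > 1" using primepow_gt_Suc_0[OF primepow] by simp

lemma f_linear:
  assumes j: "j \<in> {1..t}"
  shows f_add: "f1 j x + f1 j y = f1 j (x + y) \<and> f2 j x + f2 j y = f2 j (x + y) \<and> f3 j x + f3 j y = f3 j (x + y)"
    and f_diff: "f1 j x - f1 j y = f1 j (x - y) \<and> f2 j x - f2 j y = f2 j (x - y) \<and> f3 j x - f3 j y = f3 j (x - y)"
    and f_mult: "c ^ q = c \<Longrightarrow> c * f1 j x = f1 j (c * x) \<and> c * f2 j x = f2 j (c * x) \<and> c * f3 j x = f3 j (c * x)"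
proof -
  note lin = admissible_q_linear[OF field_facts adm[OF j]]
  have add: "f1 j x + f1 j y = f1 j (x + y)" "f2 j x + f2 j y = f2 j (x + y)" "f3 j x + f3 j y = f3 j (x + y)" for x y
    using lin(1)[of "f1 j" x y] lin(1)[of "f2 j" x y] lin(1)[of "f3 j" x y] by auto
  then show "f1 j x + f1 j y = f1 j (x + y) \<and> f2 j x + f2 j y = f2 j (x + y) \<and> f3 j x + f3 j y = f3 j (x + y)"
    by blast
  show "f1 j x - f1 j y = f1 j (x - y) \<and> f2 j x - f2 j y = f2 j (x - y) \<and> f3 j x - f3 j y = f3 j (x - y)"
    using add[of "x - y" y] by (simp add: diff_eq_eq)
  show "c * f1 j x = f1 j (c * x) \<and> c * f2 j x = f2 j (c * x) \<and> c * f3 j x = f3 j (c * x)" if "c ^ q = c"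
    using lin(2)[of "f1 j" c x] lin(2)[of "f2 j" c x] lin(2)[of "f3 j" c x] that by auto
qed

lemma U_carrier: "U \<subseteq> carrier_vec (3 * t)"
  by (auto simp: U_def)

lemma U_add: "u \<in> U \<Longrightarrow> v \<in> U \<Longrightarrow> u + v \<in> U"
proof -
  assume "u \<in> U" "v \<in> U"
  then obtain x y where "u = triple_vec t f1 f2 f3 x" "v = triple_vec t f1 f2 f3 y"
    by (auto simp: U_def)
  then have "u + v = triple_vec t f1 f2 f3 (\<lambda>j. x j + y j)"
    by (simp only: triple_vec_add[where z = x]) (rule triple_vec_cong, rule f_add)
  then show ?thesis by (simp add: U_def)
qed

lemma U_diff: "u \<in> U \<Longrightarrow> v \<in> U \<Longrightarrow> u - v \<in> U"
proof -
  assume "u \<in> U" "v \<in> U"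
  then obtain x y where "u = triple_vec t f1 f2 f3 x" "v = triple_vec t f1 f2 f3 y"
    by (auto simp: U_def)
  then have "u - v = triple_vec t f1 f2 f3 (\<lambda>j. x j - y j)"
    by (simp only: triple_vec_diff[where z = x]) (rule triple_vec_cong, rule f_diff)
  then show ?thesis by (simp add: U_def)
qed

lemma U_smult: "c ^ q = c \<Longrightarrow> u \<in> U \<Longrightarrow> c \<cdot>\<^sub>v u \<in> U"
proof -
  assume c: "c ^ q = c" and "u \<in> U"
  then obtain x where "u = triple_vec t f1 f2 f3 x"
    by (auto simp: U_def)
  then have "c \<cdot>\<^sub>v u = triple_vec t f1 f2 f3 (\<lambda>j. c * x j)"
    by (simp only: triple_vec_smult[where z = x]) (rule triple_vec_cong, rule f_mult[OF _ c])
  then show ?thesis by (simp add: U_def)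
qed

lemma U_image: "U = triple_vec t f1 f2 f3 ` ({1..t} \<rightarrow>\<^sub>E UNIV)"
proof -
  have "triple_vec t f1 f2 f3 x \<in> triple_vec t f1 f2 f3 ` ({1..t} \<rightarrow>\<^sub>E UNIV)" for x
  proof (rule image_eqI)
    show "triple_vec t f1 f2 f3 x = triple_vec t f1 f2 f3 (restrict x {1..t})"
      by (rule triple_vec_cong) simp
  qed simp
  then show ?thesis unfolding U_def by blast
qed

lemma finite_U: "finite U"
  unfolding U_image by (intro finite_imageI finite_PiE) auto

lemma card_U_le: "card U \<le> q ^ (n * t)"
proof -
  have "card U \<le> card ({1..t} \<rightarrow>\<^sub>E (UNIV :: 'a set))"
    unfolding U_image by (intro card_image_le finite_PiE) auto
  also have "\<dots> = q ^ (n * t)" by (simp add: card_PiE card_field power_mult)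
  finally show ?thesis .
qed

lemma zero_in_U: "0\<^sub>v (3 * t) \<in> U"
proof -
  let ?u = "triple_vec t f1 f2 f3 (\<lambda>_. 0)"
  have "?u - ?u \<in> U" by (rule U_diff) (auto simp: U_def)
  moreover have "?u - ?u = 0\<^sub>v (3 * t)" by (rule minus_cancel_vec) simp
  ultimately show ?thesis by simp
qed

lemma N_times: "N * (q - 1) = q ^ (n * t) - 1"
  unfolding N_eq using pred_dvd_power_pred by (simp del: One_nat_def)

lemma card_U: "card U = q ^ (n * t)"
  and zero_coordinates: "a \<in> carrier_vec (3 * t) \<Longrightarrow>
    card {j. j < N \<and> col G j \<bullet> a = 0} * (q - 1) + 1 = card {u \<in> U. u \<bullet> a = 0}"
  using points_partition[OF finite_U U_carrier zero_in_U U_smult card_frobenius_fixed[OF field_facts]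
    _ G cols[folded U_def] N_times card_U_le] q_gt_1 by auto

lemma dot_image_eq:
  assumes "a \<in> carrier_vec (3 * t)"
  shows "dot_image a = range (\<lambda>x. \<Sum>j<t. component a j (x (j + 1)))"
  unfolding dot_image_def U_def component_def
  by (simp add: image_image triple_vec_scalar_prod[OF assms])

lemma card_dot_image_times_card_perp:
  assumes "a \<in> carrier_vec (3 * t)"
  shows "card (dot_image a) * card {u \<in> U. u \<bullet> a = 0} = q ^ (n * t)"
  using card_image_times_card_perp[OF finite_U U_carrier U_add U_diff assms]
  by (simp add: dot_image_def card_U)

lemma component_add: "j < t \<Longrightarrow> component a j (x + y) = component a j x + component a j y"
  unfolding component_def by (rule combination_q_linear(1)[OF field_facts]) (use adm in auto)

lemma component_zero: "j < t \<Longrightarrow> component a j 0 = 0"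
proof -
  assume "j < t"
  then have "component a j 0 + component a j 0 = component a j 0 + 0" using component_add[of j a 0 0] by simp
  then show ?thesis by (rule add_left_imp_eq)
qed

lemma card_range_component: "j < t \<Longrightarrow> card (range (component a j)) * card {x. component a j x = 0} = q ^ n"
  by (rule card_range_times_card_kernel[OF field_facts]) (rule component_add)

lemma sum_component_single:
  assumes "j < t"
  shows "(\<Sum>i<t. component a i (if i + 1 = j + 1 then y else 0)) = component a j y"
proof -
  have "(\<Sum>i<t. component a i (if i + 1 = j + 1 then y else 0)) = (\<Sum>i<t. if i = j then component a j y else 0)"
    by (rule sum.cong) (auto simp: component_zero)
  then show ?thesis using assms by simp
qed

lemma range_component_subset:
  assumes "a \<in> carrier_vec (3 * t)" and "j < t"
  shows "range (component a j) \<subseteq> dot_image a"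
  unfolding dot_image_eq[OF assms(1)]
proof
  fix z assume "z \<in> range (component a j)"
  then obtain y where "z = component a j y" by auto
  then show "z \<in> range (\<lambda>x. \<Sum>j<t. component a j (x (j + 1)))"
    using sum_component_single[OF assms(2), of a y]
    by (intro range_eqI[where x = "\<lambda>k. if k = j + 1 then y else 0"]) simp
qed

text \<open>
  The values \<open>u \<bullet> a\<close> form a subspace over the field of order \<open>q\<close>, so their number is a power of
  \<open>q\<close>. A nonzero \<open>a\<close> has a nonzero coefficient in some block, and already the image of that block
  has at least \<open>q ^ (n - 2)\<close> elements.
\<close>

lemma card_dot_image:
  assumes a: "a \<in> carrier_vec (3 * t)" "a \<noteq> 0\<^sub>v (3 * t)"
  shows "\<exists>k\<in>{n - 2, n - 1, n}. card (dot_image a) = q ^ k"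
proof -
  have car: "u \<in> carrier_vec (3 * t)" if "u \<in> U" for u using that U_carrier by auto
  have "\<exists>k. card (dot_image a) = q ^ k"
  proof (rule card_q_subspace[OF field_facts])
    have "0\<^sub>v (3 * t) \<bullet> a \<in> dot_image a" unfolding dot_image_def using zero_in_U by (rule imageI)
    then show "0 \<in> dot_image a" using a by simp
  next
    fix x y assume "x \<in> dot_image a" "y \<in> dot_image a"
    then obtain u v where uv: "u \<in> U" "v \<in> U" "x = u \<bullet> a" "y = v \<bullet> a" by (auto simp: dot_image_def)
    then have "x + y = (u + v) \<bullet> a" using car a by (simp add: add_scalar_prod_distrib[of _ "3 * t"])
    then show "x + y \<in> dot_image a" unfolding dot_image_def using U_add[OF uv(1,2)] by blast
  next
    fix c x :: 'a assume c: "c ^ q = c" and "x \<in> dot_image a"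
    then obtain u where u: "u \<in> U" "x = u \<bullet> a" by (auto simp: dot_image_def)
    then have "c * x = (c \<cdot>\<^sub>v u) \<bullet> a" using car a by simp
    then show "c * x \<in> dot_image a" unfolding dot_image_def using U_smult[OF c u(1)] by blast
  qed
  then obtain k where k: "card (dot_image a) = q ^ k" by blast
  have "q ^ k \<le> q ^ n" using card_mono[of UNIV "dot_image a"] by (simp add: k card_field)
  then have "k \<le> n" by (rule power_le_imp_le_exp[OF q_gt_1])
  moreover have "n \<le> k + 2"
  proof -
    obtain l where l: "l < 3 * t" "a $ l \<noteq> 0"
      using a by (metis carrier_vecD eq_vecI index_zero_vec)
    define j where "j = l div 3"
    have j: "j < t" using l by (simp add: j_def)
    have "l = 3 * j \<or> l = 3 * j + 1 \<or> l = 3 * j + 2" unfolding j_def by presburger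
    then have "a $ (3 * j) \<noteq> 0 \<or> a $ (3 * j + 1) \<noteq> 0 \<or> a $ (3 * j + 2) \<noteq> 0" using l by auto
    then have "card {x. component a j x = 0} \<le> q\<^sup>2"
      unfolding component_def using adm j by (intro card_kernel_admissible[OF field_facts]) auto
    moreover have "card (range (component a j)) \<le> card (dot_image a)"
      using range_component_subset[OF a(1) j] by (intro card_mono) auto
    ultimately have "q ^ n \<le> q ^ k * q\<^sup>2"
      unfolding card_range_component[OF j, of a, symmetric] k by (intro mult_mono) auto
    then have "q ^ n \<le> q ^ (k + 2)" by (simp only: power_add)
    then show ?thesis by (rule power_le_imp_le_exp[OF q_gt_1])
  qed
  ultimately have "k \<in> {n - 2, n - 1, n}" by auto
  with k show ?thesis by blast
qed

text \<open>
  A vector supported on the first block reduces the image to that of a single combination of the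
  first triple.
\<close>

lemma ex_dot_image:
  assumes "b \<noteq> 0 \<or> c \<noteq> 0 \<or> d \<noteq> 0"
  shows "\<exists>a. a \<in> carrier_vec (3 * t) \<and> a \<noteq> 0\<^sub>v (3 * t) \<and>
    card (dot_image a) * card {x. b * f1 1 x + c * f2 1 x + d * f3 1 x = 0} = q ^ n"
proof -
  define a where "a = vec (3 * t) (\<lambda>i. if i = 0 then b else if i = 1 then c else if i = 2 then d else 0)"
  have a: "a \<in> carrier_vec (3 * t)" by (simp add: a_def)
  have a_nth: "a $ 0 = b" "a $ 1 = c" "a $ 2 = d" using t by (simp_all add: a_def)
  have "a \<noteq> 0\<^sub>v (3 * t)"
  proof
    assume "a = 0\<^sub>v (3 * t)"
    then have "a $ 0 = 0" "a $ 1 = 0" "a $ 2 = 0" using t by simp_all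
    with a_nth assms show False by simp
  qed
  moreover have component_0: "component a 0 x = b * f1 1 x + c * f2 1 x + d * f3 1 x" for x
    using a_nth by (simp add: component_def numeral_2_eq_2)
  have component_pos: "component a j x = 0" if "0 < j" "j < t" for j x
    using that by (simp add: component_def a_def)
  have "(\<Sum>j<t. component a j (x (j + 1))) = component a 0 (x 1)" for x
  proof -
    have "(\<Sum>j<t. component a j (x (j + 1))) = (\<Sum>j<t. if j = 0 then component a 0 (x 1) else 0)"
      by (rule sum.cong) (auto simp: component_pos)
    then show ?thesis using t by simp
  qed
  then have "dot_image a \<subseteq> range (component a 0)" by (auto simp: dot_image_eq[OF a])
  then have "dot_image a = range (component a 0)" using range_component_subset[OF a, of 0] t by auto
  then have "card (dot_image a) * card {x. component a 0 x = 0} = q ^ n"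
    using card_range_component[of 0 a] t by simp
  ultimately show ?thesis using a by (auto simp: component_0)
qed

text \<open>
  On the first triple, rank \<open>n\<close> is attained by \<open>f1\<close>, which is injective, rank \<open>n - 1\<close> by
  \<open>f2 - f1\<close>, whose roots form the field of order \<open>q\<close>, and rank \<open>n - 2\<close> by a combination that
  vanishes on a plane.
\<close>

lemma all_ranks_occur:
  assumes "k \<in> {n - 2, n - 1, n}"
  shows "\<exists>a. a \<in> carrier_vec (3 * t) \<and> a \<noteq> 0\<^sub>v (3 * t) \<and> card (dot_image a) = q ^ k"
proof -
  have adm1: "admissible_triple q n (f1 1) (f2 1) (f3 1)" using adm t by simp
  have "\<exists>b c d. (b \<noteq> 0 \<or> c \<noteq> 0 \<or> d \<noteq> 0) \<and>
      card {x. b * f1 1 x + c * f2 1 x + d * f3 1 x = 0} = q ^ (n - k)"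
  proof -
    consider "k = n - 2" | "k = n - 1" | "k = n" using assms by blast
    then show ?thesis
    proof cases
      case 1
      then have "n - k = 2" using n by simp
      then show ?thesis using ex_two_dimensional_kernel[OF field_facts _ adm1] n by simp
    next
      case 2
      then have "n - k = 1" using n by simp
      moreover have "- 1 * x + 1 * y + 0 * z = 0 \<longleftrightarrow> y = x" for x y z :: 'a by auto
      ultimately show ?thesis using admissible_card_equal[OF field_facts adm1]
        by (intro exI[of _ "- 1"] exI[of _ 1] exI[of _ 0]) (simp only:, simp)
    next
      case 3
      have "f1 1 0 = 0" using f_diff[of 1 0 0] t by simp
      then have "f1 1 x = 0 \<longleftrightarrow> x = 0" for x
        using admissible_inj[OF field_facts adm1] by (metis injD)
      then show ?thesis using 3 by (intro exI[of _ 1] exI[of _ 0]) simp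
    qed
  qed
  then obtain b c d where bcd: "b \<noteq> 0 \<or> c \<noteq> 0 \<or> d \<noteq> 0"
      "card {x. b * f1 1 x + c * f2 1 x + d * f3 1 x = 0} = q ^ (n - k)" by blast
  obtain a where a: "a \<in> carrier_vec (3 * t)" "a \<noteq> 0\<^sub>v (3 * t)"
      "card (dot_image a) * q ^ (n - k) = q ^ n"
    using ex_dot_image[OF bcd(1)] unfolding bcd(2) by blast
  have "k \<le> n" using assms n by auto
  then have "card (dot_image a) * q ^ (n - k) = q ^ k * q ^ (n - k)"
    using a(3) by (simp flip: power_add)
  then have "card (dot_image a) = q ^ k" using q_gt_1 by simp
  then show ?thesis using a by blast
qed

lemma weight:
  assumes a: "a \<in> carrier_vec (3 * t)"
  shows "hamming_weight (G\<^sup>T *\<^sub>v a) * (q - 1) + card {u \<in> U. u \<bullet> a = 0} = q ^ (n * t)"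
proof -
  let ?Z = "{j. j < N \<and> col G j \<bullet> a = 0}" and ?S = "{j. j < N \<and> col G j \<bullet> a \<noteq> 0}"
  have "(G\<^sup>T *\<^sub>v a) $ j = col G j \<bullet> a" if "j < N" for j using that G by simp
  then have "{j. j < dim_vec (G\<^sup>T *\<^sub>v a) \<and> (G\<^sup>T *\<^sub>v a) $ j \<noteq> 0} = ?S"
    using G by (auto simp del: index_mult_mat_vec)
  then have "hamming_weight (G\<^sup>T *\<^sub>v a) = card ?S" by (simp only: hamming_weight_def)
  moreover have "card ?Z + card ?S = N"
  proof -
    have "?Z \<union> ?S = {..<N}" by auto
    then have "card (?Z \<union> ?S) = N" by simp
    then show ?thesis by (subst (asm) card_Un_disjoint) auto
  qed
  ultimately have "(hamming_weight (G\<^sup>T *\<^sub>v a) + card ?Z) * (q - 1) = q ^ (n * t) - 1"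
    using N_times by (simp only: add.commute)
  then have "hamming_weight (G\<^sup>T *\<^sub>v a) * (q - 1) + card ?Z * (q - 1) = q ^ (n * t) - 1"
    by (simp only: add_mult_distrib)
  moreover have "q ^ (n * t) > 0" using q_gt_1 by simp
  ultimately show ?thesis using zero_coordinates[OF a] by linarith
qed

text \<open>
  The weight of a codeword whose coefficient vector takes \<open>q ^ k\<close> values on \<open>U\<close>.
\<close>

definition wt :: "nat \<Rightarrow> nat" where "wt k = (q ^ (n * t) - q ^ (n * t - k)) div (q - 1)"

text \<open>
  By counting fibres, \<open>q ^ (n * t - k)\<close> vectors of \<open>U\<close> are orthogonal to \<open>a\<close>; the zero
  coordinates of the codeword are the points among them.
\<close>

lemma weight_of_rank:
  assumes a: "a \<in> carrier_vec (3 * t)" and k: "card (dot_image a) = q ^ k" "k \<le> n"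
  shows "hamming_weight (G\<^sup>T *\<^sub>v a) = wt k"
    and "hamming_weight (G\<^sup>T *\<^sub>v a) * (q - 1) + q ^ (n * t - k) = q ^ (n * t)"
proof -
  have "n * 1 \<le> n * t" using t by (intro mult_le_mono2) simp
  then have "k \<le> n * t" using k(2) by linarith
  then have "q ^ k * card {u \<in> U. u \<bullet> a = 0} = q ^ k * q ^ (n * t - k)"
    using card_dot_image_times_card_perp[OF a] k by (simp flip: power_add)
  then have perp: "card {u \<in> U. u \<bullet> a = 0} = q ^ (n * t - k)" using q_gt_1 by simp
  then show *: "hamming_weight (G\<^sup>T *\<^sub>v a) * (q - 1) + q ^ (n * t - k) = q ^ (n * t)"
    using weight[OF a] by simp
  then have "q ^ (n * t) - q ^ (n * t - k) = hamming_weight (G\<^sup>T *\<^sub>v a) * (q - 1)" by linarith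
  then show "hamming_weight (G\<^sup>T *\<^sub>v a) = wt k" using q_gt_1 by (simp add: wt_def)
qed

lemma wt_pos_and_distinct:
  assumes "k \<in> {n - 2, n - 1, n}"
  shows "wt k > 0" and "k' \<in> {n - 2, n - 1, n} \<Longrightarrow> wt k = wt k' \<Longrightarrow> k = k'"
proof -
  have eq: "wt i * (q - 1) + q ^ (n * t - i) = q ^ (n * t)" if i: "i \<in> {n - 2, n - 1, n}" for i
  proof -
    obtain a where a: "a \<in> carrier_vec (3 * t)" "card (dot_image a) = q ^ i"
      using all_ranks_occur[OF i] by blast
    have "i \<le> n" using i by auto
    from weight_of_rank[OF a this] show ?thesis by simp
  qed
  have le: "i \<le> n * t" if "i \<in> {n - 2, n - 1, n}" for i
  proof -
    have "i \<le> n" "n \<le> n * t" using that t by auto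
    then show ?thesis by (rule le_trans)
  qed
  show "wt k > 0"
  proof (rule ccontr)
    assume "\<not> wt k > 0"
    then have "q ^ (n * t - k) = q ^ (n * t)" using eq[OF assms] by simp
    then have "n * t - k = n * t" using q_gt_1 by (simp add: power_inject_exp)
    then have "k = 0" using le[OF assms] by linarith
    then show False using assms n by auto
  qed
  assume k': "k' \<in> {n - 2, n - 1, n}" and "wt k = wt k'"
  then have "q ^ (n * t - k) = q ^ (n * t - k')" using eq[OF assms] eq[OF k'] by simp
  then have "n * t - k = n * t - k'" using q_gt_1 by (simp add: power_inject_exp)
  then show "k = k'" using le[OF assms] le[OF k'] by simp
qed

lemma hamming_weight_zero: "hamming_weight (0\<^sub>v m :: 'a vec) = 0"
  by (simp add: hamming_weight_def)

lemma nonzero_codeword: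
  assumes a: "a \<in> carrier_vec (3 * t)" "a \<noteq> 0\<^sub>v (3 * t)"
  shows "\<exists>k\<in>{n - 2, n - 1, n}. hamming_weight (G\<^sup>T *\<^sub>v a) = wt k"
    and "G\<^sup>T *\<^sub>v a \<noteq> 0\<^sub>v N"
proof -
  obtain k where k: "k \<in> {n - 2, n - 1, n}" "card (dot_image a) = q ^ k"
    using card_dot_image[OF a] by blast
  then have *: "hamming_weight (G\<^sup>T *\<^sub>v a) = wt k"
    by (intro weight_of_rank(1)[OF a(1)]) auto
  then show "\<exists>k\<in>{n - 2, n - 1, n}. hamming_weight (G\<^sup>T *\<^sub>v a) = wt k" using k(1) by blast
  show "G\<^sup>T *\<^sub>v a \<noteq> 0\<^sub>v N"
    using * wt_pos_and_distinct(1)[OF k(1)] hamming_weight_zero by (metis less_irrefl)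
qed

lemma three_weight_generator:
  "\<exists>C. three_weight_code N (3 * t) C \<and> generator_matrix N (3 * t) G C"
proof -
  let ?C = "(\<lambda>a. G\<^sup>T *\<^sub>v a) ` carrier_vec (3 * t)"
  have inj: "a = 0\<^sub>v (3 * t)" if "a \<in> carrier_vec (3 * t)" "G\<^sup>T *\<^sub>v a = 0\<^sub>v N" for a
    using nonzero_codeword(2) that by blast
  have zero: "G\<^sup>T *\<^sub>v 0\<^sub>v (3 * t) = 0\<^sub>v N" using G by (intro eq_vecI) auto
  have "hamming_weight ` (?C - {0\<^sub>v N}) = wt ` {n - 2, n - 1, n}"
  proof (intro equalityI subsetI)
    fix w assume "w \<in> hamming_weight ` (?C - {0\<^sub>v N})"
    then obtain a where a: "a \<in> carrier_vec (3 * t)" "G\<^sup>T *\<^sub>v a \<noteq> 0\<^sub>v N" "w = hamming_weight (G\<^sup>T *\<^sub>v a)"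
      by blast
    then have "a \<noteq> 0\<^sub>v (3 * t)" using zero by metis
    then show "w \<in> wt ` {n - 2, n - 1, n}" using nonzero_codeword(1)[OF a(1)] a(3) by blast
  next
    fix w assume "w \<in> wt ` {n - 2, n - 1, n}"
    then obtain k where k: "k \<in> {n - 2, n - 1, n}" "w = wt k" by blast
    obtain a where a: "a \<in> carrier_vec (3 * t)" "a \<noteq> 0\<^sub>v (3 * t)" "card (dot_image a) = q ^ k"
      using all_ranks_occur[OF k(1)] by blast
    have "w = hamming_weight (G\<^sup>T *\<^sub>v a)"
      using weight_of_rank(1)[OF a(1,3)] k by auto
    then show "w \<in> hamming_weight ` (?C - {0\<^sub>v N})" using a nonzero_codeword(2)[OF a(1,2)] by blast
  qed
  moreover have "inj_on wt {n - 2, n - 1, n}"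
    by (rule inj_onI) (rule wt_pos_and_distinct(2))
  moreover have "card {n - 2, n - 1, n} = 3"
  proof -
    have "n - 2 \<noteq> n - 1" "n - 2 \<noteq> n" "n - 1 \<noteq> n" using n by auto
    then show ?thesis by (simp del: One_nat_def)
  qed
  ultimately have "card (hamming_weight ` (?C - {0\<^sub>v N})) = 3" by (simp only: card_image)
  then show ?thesis
    using generator_matrix_of_injective[OF G inj] unfolding three_weight_code_def by blast
qed

end

theorem theorem7p3:
  fixes q n t N :: nat
    and f1 f2 f3 :: "nat \<Rightarrow> 'a::{field, finite} \<Rightarrow> 'a"
    and G :: "'a mat"
  assumes "primepow q"
    and "n \<ge> 3"
    and "t \<ge> 2"
    and "CARD('a) = q ^ n"
    and "N = (q ^ (n * t) - 1) div (q - 1)"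
    and "\<And>j. j \<in> {1..t} \<Longrightarrow> admissible_triple q n (f1 j) (f2 j) (f3 j)"
    and "G \<in> carrier_mat (3 * t) N"
    and "columns_one_per_point G (range (triple_vec t f1 f2 f3) - {0\<^sub>v (3 * t)})"
  shows "\<exists>C. three_weight_code N (3 * t) C \<and> generator_matrix N (3 * t) G C"
proof -
  interpret triple_code q n t N f1 f2 f3 G
    by (rule triple_code.intro) (fact assms)+
  show ?thesis by (rule three_weight_generator)
qed

end
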